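(* Let $A$, $B$, $C$ and $C'$ be matrices in $\mathbb{C}^{d\times d}$, with $C+kI$ and $C'+kI$ invertible for all integers $k\ge0$. Then the matrix function $\mathcal{H}_{11}(A,B,C;C';x,y)$ satisfies the following infinite summation formulae for $|t|<1$: (1) $(1-t)^{-A}\,\mathcal{H}_{11}\!\left(A,B,C;C';\frac{x}{1-t},y(1-t)\right)=\sum_{n=0}^{\infty}\frac{(A)_n}{n!}\,\mathcal{H}_{11}(A+nI,B,C;C';x,y)\,t^n$; (2) if $AB=BA$, $(1-t)^{-B}\,\mathcal{H}_{11}\!\left(A,B,C;C';x,\frac{y}{1-t}\right)=\sum_{n=0}^{\infty}\frac{(B)_n}{n!}\,\mathcal{H}_{11}(A,B+nI,C;C';x,y)\,t^n$; (3) if $CC'=C'C$, $\mathcal{H}_{11}\!\left(A,B,C;C';x,\frac{y}{1-t}\right)(1-t)^{-C}=\sum_{n=0}^{\infty}\mathcal{H}_{11}(A,B,C+nI;C';x,y)\,\frac{(C)_n}{n!}\,t^n$.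
   Context: $\mathcal{H}_{11}(A,B,C;C';x,y)=\sum_{m,n\ge0}(A)_{m-n}(B)_n(C)_n(C')_m^{-1}\frac{x^m y^n}{m!\,n!}$. Matrix Pochhammer symbol: for $M\in\mathbb{C}^{d\times d}$, $(M)_0=I$, $(M)_n=M(M+I)\cdots(M+(n-1)I)$ for $n\ge1$, and $(M)_{-n}=(-1)^n(I-M)_n^{-1}$; $(M)_n^{-1}$ is the inverse matrix of $(M)_n$. For $|t|<1$, $(1-t)^{-M}=\sum_{n\ge0}\frac{(M)_n}{n!}t^n$.
   Formalization: Added: A-kI (k≥1) invertible, in (1) also A+kI (k≥0); (x,y) and the transformed point have second coordinate of modulus <1; the identity holds when the right-hand series converges, proved for |y|(1+|t|)<1 in (1), |y|+|t|<1 in (2),(3), as it can diverge for some |t|<1. *)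

theory Defs
  imports "HOL-Analysis.Analysis"
begin

(* On the type complex ^ 'd ^ 'd the library's "*" is the entrywise product, so matrix products are
   always written "**" and the scalar matrix c I is "mat c". *)

definition mscale :: "complex \<Rightarrow> complex ^ 'd ^ 'd \<Rightarrow> complex ^ 'd ^ 'd" where
  "mscale c M = (\<chi> i j. c * M $ i $ j)"

primrec mpoch :: "complex ^ 'd ^ 'd \<Rightarrow> nat \<Rightarrow> complex ^ 'd ^ 'd" where
  "mpoch M 0 = mat 1"
| "mpoch M (Suc n) = mpoch M n ** (M + mat (of_nat n))"

(* (M)_k for integer k. For k = -n < 0 this is (-1)^n times the inverse of (I - M)_n, meaningful
   only if (I - M)_n is invertible, i.e. if M - I, ..., M - nI are. *)
definition mpoch_int :: "complex ^ 'd ^ 'd \<Rightarrow> int \<Rightarrow> complex ^ 'd ^ 'd" where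
  "mpoch_int M k =
     (if k \<ge> 0 then mpoch M (nat k)
      else mscale ((-1) ^ nat (- k)) (matrix_inv (mpoch (mat 1 - M) (nat (- k)))))"

(* (1 - t)^(-M), for |t| < 1 *)
definition mbinom :: "complex \<Rightarrow> complex ^ 'd ^ 'd \<Rightarrow> complex ^ 'd ^ 'd" where
  "mbinom t M = (\<Sum>n. mscale (t ^ n / fact n) (mpoch M n))"

definition horn_H11 :: "complex ^ 'd ^ 'd \<Rightarrow> complex ^ 'd ^ 'd \<Rightarrow> complex ^ 'd ^ 'd \<Rightarrow>
    complex ^ 'd ^ 'd \<Rightarrow> complex \<Rightarrow> complex \<Rightarrow> complex ^ 'd ^ 'd" where
  "horn_H11 A B C C' x y =
     (\<Sum>\<^sub>\<infinity>(m, n)\<in>UNIV. mscale (x ^ m * y ^ n / (fact m * fact n))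
        (mpoch_int A (int m - int n) ** mpoch B n ** mpoch C n ** matrix_inv (mpoch C' m)))"

(* Region of absolute convergence of the double series for all parameters: the coefficient of
   x^m y^n is bounded by a polynomial in m, n times n! / ((n - m)! m! m!) for n > m and
   (m - n)! n! / (m! m!) for n \<le> m, so x is unrestricted and |y| < 1. *)
definition horn_H11_region :: "(complex \<times> complex) set" where
  "horn_H11_region = {(x, y). cmod y < 1}"

end

theory Submission
  imports Defs "HOL-Complex_Analysis.Conformal_Mappings"
begin

text \<open>
  Fix all data except \<open>t\<close> and write \<open>s\<close> for it. After the binomial factor has been absorbed,
  the left-hand side of each formula is a double series
  \<open>L s = \<Sum> (1 - s)\<^bsup>-(M + p)\<^esup> E\<close> over \<open>(m, k)\<close>, in which \<open>E\<close> is the term of the Horn series at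
  \<open>(x, y)\<close> and \<open>M\<close> is the parameter that is raised; \<open>p = m - k\<close> when \<open>M = A\<close>, and \<open>p = k\<close> when
  \<open>M\<close> is \<open>B\<close> or \<open>C\<close>. (For \<open>C\<close> the product is taken in the opposite order.) The \<open>n\<close>-th Taylor
  coefficient of such a term is \<open>(M + p)\<^sub>n E / n!\<close>, and the identity
  \<open>(M)\<^sub>n (M + n)\<^sub>p = (M + p)\<^sub>n (M)\<^sub>p\<close> turns it into \<open>(M)\<^sub>n / n!\<close> times the term of the Horn
  series with \<open>M + nI\<close> in place of \<open>M\<close>. So the right-hand side is, formally, the Taylor series of
  \<open>L\<close> at \<open>0\<close>.

  This is made rigorous without ever forming the triple series over \<open>m\<close>, \<open>k\<close> and \<open>n\<close>. The double
  series converges locally uniformly on the open set \<open>U\<close> of those \<open>s\<close> in the unit disc for which the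
  arguments of the Horn function lie in its region of convergence; \<open>H11_majorant_summable\<close> supplies
  the majorant. Hence \<open>L\<close> is holomorphic on \<open>U\<close> and may be differentiated term by term
  (\<open>holomorphic_infsum\<close>), which gives the Taylor coefficients. The largest disc about \<open>0\<close> inside
  \<open>U\<close> has radius \<open>min 1 (1 / \<bar>y\<bar> - 1)\<close> for the first formula (\<open>1\<close> if \<open>y = 0\<close>) and
  \<open>1 - \<bar>y\<bar>\<close> for the other two, and the Taylor series converges there.

  At other points \<open>t\<close> of \<open>U\<close> the series need not converge, but if it does, its sum is \<open>L t\<close>: the
  sum is holomorphic for \<open>\<bar>s\<bar> < \<bar>t\<bar>\<close>, it agrees with \<open>L\<close> on the connected set
  \<open>U \<inter> ball 0 \<bar>t\<bar>\<close>, and Abel's limit theorem covers the point \<open>t\<close> on the boundary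
  (\<open>Taylor_sums_at_boundary\<close>). For the first formula that set is convex, for the other two it is a
  disc with a bite taken out of it (\<open>connected_ball_minus_cball\<close>). The lemma
  \<open>binomial_generating_series\<close> puts these steps together.
\<close>

section \<open>Complex matrices: scalars, norm and inverses\<close>

lemma mscale_nth [simp]: "mscale c M $ i $ j = c * M $ i $ j"
  by (simp add: mscale_def)

lemma mscale_mscale [simp]: "mscale a (mscale b M) = mscale (a * b) M"
  by (simp add: vec_eq_iff mult.assoc)

lemma mscale_1 [simp]: "mscale 1 M = M"
  by (simp add: vec_eq_iff)

lemma mscale_mult_left: "mscale c M ** N = mscale c (M ** N)"
  by (simp add: vec_eq_iff matrix_matrix_mult_def sum_distrib_left mult.assoc)

lemma mscale_mult_right: "M ** mscale c N = mscale c (M ** N)"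
  by (simp add: vec_eq_iff matrix_matrix_mult_def sum_distrib_left algebra_simps)

lemma mat_mult_left: "mat c ** M = mscale c (M :: complex ^ 'd ^ 'd)"
  by (simp add: vec_eq_iff matrix_matrix_mult_def mat_def if_distrib[where f = "\<lambda>x. x * _"] cong: if_cong)

lemma mat_mult_right: "M ** mat c = mscale c (M :: complex ^ 'd ^ 'd)"
  by (simp add: vec_eq_iff matrix_matrix_mult_def mat_def if_distrib[where f = "\<lambda>x. _ * x"] algebra_simps cong: if_cong)

lemma mat_add: "mat a + mat b = (mat (a + b) :: complex ^ 'd ^ 'd)"
  by (simp add: vec_eq_iff mat_def)

lemma norm_mscale: "norm (mscale c M) = cmod c * norm M"
proof -
  have "norm (mscale c M $ i) = cmod c * norm (M $ i)" for i
    by (simp add: norm_vec_def norm_mult L2_set_right_distrib)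
  then show ?thesis
    by (simp add: norm_vec_def[of "mscale c M"] norm_vec_def[of M] L2_set_right_distrib)
qed

lemma bounded_linear_mscale: "bounded_linear (mscale c)"
proof (rule bounded_linear_intro)
  show "norm (mscale c M) \<le> norm M * cmod c" for M :: "complex ^ 'd ^ 'd"
    by (simp add: norm_mscale)
qed (simp_all add: vec_eq_iff algebra_simps)

lemma norm_entry_le: "cmod (M $ i $ j) \<le> norm M"
  by (meson Finite_Cartesian_Product.norm_nth_le order_trans)

lemma norm_le_sum_entries: "norm M \<le> (\<Sum>i\<in>UNIV. \<Sum>j\<in>UNIV. cmod (M $ i $ j))"
proof -
  have "norm M \<le> (\<Sum>i\<in>UNIV. norm (M $ i))"
    by (simp add: norm_vec_def L2_set_le_sum)
  also have "\<dots> \<le> (\<Sum>i\<in>UNIV. \<Sum>j\<in>UNIV. cmod (M $ i $ j))"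
    by (intro sum_mono) (simp add: norm_vec_def L2_set_le_sum)
  finally show ?thesis .
qed

lemma bounded_bilinear_matrix_mult:
  "bounded_bilinear ((**) :: complex ^ 'd ^ 'd \<Rightarrow> complex ^ 'd ^ 'd \<Rightarrow> complex ^ 'd ^ 'd)"
proof
  show "\<exists>K. \<forall>(M :: complex ^ 'd ^ 'd) (N :: complex ^ 'd ^ 'd). norm (M ** N) \<le> norm M * norm N * K"
  proof (rule exI[of _ "(real CARD('d)) ^ 3"], intro allI)
    fix M N :: "complex ^ 'd ^ 'd"
    have "cmod ((M ** N) $ i $ j) \<le> (\<Sum>k\<in>(UNIV :: 'd set). norm M * norm N)" for i j
      unfolding matrix_matrix_mult_def
      by (simp, rule order_trans[OF norm_sum], rule sum_bounded_above)
         (simp add: norm_mult mult_mono norm_entry_le)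
    then have "norm (M ** N) \<le> (\<Sum>i\<in>(UNIV :: 'd set). \<Sum>j\<in>(UNIV :: 'd set). \<Sum>k\<in>(UNIV :: 'd set). norm M * norm N)"
      by (intro order_trans[OF norm_le_sum_entries] sum_mono)
    then show "norm (M ** N) \<le> norm M * norm N * real CARD('d) ^ 3"
      by (simp add: power3_eq_cube mult_ac)
  qed
qed (simp_all add: vec_eq_iff matrix_matrix_mult_def sum.distrib algebra_simps scaleR_sum_right)

lemmas matrix_add_rdistrib = bounded_bilinear.add_left[OF bounded_bilinear_matrix_mult]
  and matrix_sub_rdistrib = bounded_bilinear.diff_left[OF bounded_bilinear_matrix_mult]
  and matrix_sub_ldistrib = bounded_bilinear.diff_right[OF bounded_bilinear_matrix_mult]

lemma has_sum_matrixI: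
  fixes f :: "'a \<Rightarrow> complex ^ 'd ^ 'd"
  assumes "\<And>i j. ((\<lambda>x. f x $ i $ j) has_sum s $ i $ j) X"
  shows "(f has_sum s) X"
  using assms unfolding has_sum_def by (intro vec_tendstoI) simp

lemma sums_matrixI:
  fixes f :: "nat \<Rightarrow> complex ^ 'd ^ 'd"
  assumes "\<And>i j. (\<lambda>n. f n $ i $ j) sums (s $ i $ j)"
  shows "f sums s"
  using assms unfolding sums_def by (intro vec_tendstoI) simp

lemma bounded_linear_entry: "bounded_linear (\<lambda>M :: complex ^ 'd ^ 'd. M $ i $ j)"
  by (intro bounded_linear_compose[OF bounded_linear_vec_nth bounded_linear_vec_nth])

lemma matrix_inv_cancel:
  fixes M :: "complex ^ 'd ^ 'd"
  assumes "invertible M"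
  shows "M ** matrix_inv M = mat 1" "matrix_inv M ** M = mat 1"
  using someI_ex[OF assms[unfolded invertible_def]] by (simp_all add: matrix_inv_def)

lemma matrix_inv_commute:
  fixes M N :: "complex ^ 'd ^ 'd"
  assumes "invertible M" "M ** N = N ** M"
  shows "matrix_inv M ** N = N ** matrix_inv M"
proof -
  have "matrix_inv M ** N = matrix_inv M ** (N ** M) ** matrix_inv M"
    by (simp add: matrix_mul_assoc[symmetric] matrix_inv_cancel assms)
  also have "\<dots> = N ** matrix_inv M"
    by (simp add: assms(2)[symmetric] matrix_mul_assoc matrix_inv_cancel assms(1))
  finally show ?thesis .
qed

section \<open>Identities between matrix Pochhammer symbols\<close>

lemma invertible_mpoch:
  fixes M :: "complex ^ 'd ^ 'd"
  assumes "\<And>k. k < n \<Longrightarrow> invertible (M + mat (of_nat k))"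
  shows "invertible (mpoch M n)"
  using assms
proof (induction n)
  case 0
  show ?case by (auto simp: invertible_def intro: exI[of _ "mat 1"])
next
  case (Suc n)
  then show ?case by (auto intro!: invertible_mult)
qed

lemma mpoch_commute:
  fixes M N :: "complex ^ 'd ^ 'd"
  assumes "M ** N = N ** M"
  shows "mpoch M n ** N = N ** mpoch M n"
proof (induction n)
  case (Suc n)
  have "mpoch M n ** (M + mat (of_nat n)) ** N = mpoch M n ** N ** (M + mat (of_nat n))"
    by (simp add: matrix_mul_assoc[symmetric] matrix_add_ldistrib matrix_add_rdistrib assms mat_mult_left mat_mult_right
      mscale_mult_left)
  then show ?case by (simp add: Suc.IH matrix_mul_assoc)
qed simp

lemma mpoch_commute_mpoch:
  fixes M N :: "complex ^ 'd ^ 'd"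
  assumes "M ** N = N ** M"
  shows "mpoch M n ** mpoch N k = mpoch N k ** mpoch M n"
  by (intro mpoch_commute sym[OF mpoch_commute] sym[OF assms])

lemma mpoch_add:
  fixes M :: "complex ^ 'd ^ 'd"
  shows "mpoch M (n + k) = mpoch M n ** mpoch (M + mat (of_nat n)) k"
  by (induction k) (simp_all add: matrix_mul_assoc[symmetric] add.assoc mat_add)

lemma commute_add_mat:
  fixes M N :: "complex ^ 'd ^ 'd"
  assumes "M ** N = N ** M"
  shows "(M + mat a) ** N = N ** (M + mat a)" 
  by (simp add: matrix_add_ldistrib matrix_add_rdistrib assms mat_mult_left mat_mult_right)

text \<open>Both sides are the product of the \<open>n + k\<close> factors. \<open>M, M + I,
  \<dots>\<close>, which commute. This is the shift identity behind all three summation formulae: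
  it moves the summation index out of the parameter of one symbol into the other.\<close>
lemma mpoch_shift:
  fixes M :: "complex ^ 'd ^ 'd"
  shows "mpoch M n ** mpoch (M + mat (of_nat n)) k = mpoch (M + mat (of_nat k)) n ** mpoch M k"
proof -
  have "mpoch M n ** mpoch (M + mat (of_nat n)) k = mpoch M k ** mpoch (M + mat (of_nat k)) n"
    by (simp flip: mpoch_add add: add.commute)
  also have "\<dots> = mpoch (M + mat (of_nat k)) n ** mpoch M k"
    by (intro mpoch_commute_mpoch commute_add_mat[symmetric] refl)
  finally show ?thesis .
qed

text \<open>Reversing the order of the factors \<open>kI - M\<close> turns the defining
  denominator of a negative Pochhammer symbol into an ascending symbol that ends at \<open>M -
  I\<close>.\<close>
lemma mpoch_reflect:
  fixes M :: "complex ^ 'd ^ 'd"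
  shows "mpoch (mat 1 - M) n = mscale ((-1) ^ n) (mpoch (M - mat (of_nat n)) n)"
proof (induction n)
  case (Suc n)
  have e: "M - mat (1 + of_nat n) + mat 1 = M - mat (of_nat n)"
    and e': "mat 1 - M + mat (of_nat n) = mscale (-1) (M - mat (1 + of_nat n))"
    by (simp_all add: vec_eq_iff mat_def)
  have c: "(M - mat (1 + of_nat n)) ** (M - mat (of_nat n)) = (M - mat (of_nat n)) ** (M - mat (1 + of_nat n))"
    by (simp add: matrix_sub_ldistrib matrix_sub_rdistrib mat_mult_left mat_mult_right)
      (simp add: vec_eq_iff mat_def algebra_simps)
  have "mpoch (M - mat (of_nat (Suc n))) (Suc n) = (M - mat (1 + of_nat n)) ** mpoch (M - mat (of_nat n)) n"
    using mpoch_add[of "M - mat (of_nat (Suc n))" 1 n] by (simp add: e)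
  also have "\<dots> = mpoch (M - mat (of_nat n)) n ** (M - mat (1 + of_nat n))"
    by (rule mpoch_commute[symmetric]) (rule c[symmetric])
  finally show ?case
    by (simp add: Suc.IH e' mscale_mult_left mscale_mult_right)
qed simp

lemma matrix_inv_eqI:
  fixes M N :: "complex ^ 'd ^ 'd"
  assumes "M ** N = mat 1" shows "matrix_inv M = N"
proof -
  have "invertible M" using assms by (auto simp: invertible_right_inverse)
  have "matrix_inv M = matrix_inv M ** (M ** N)" by (simp add: assms)
  also have "\<dots> = N" by (simp add: matrix_mul_assoc matrix_inv_cancel \<open>invertible M\<close>)
  finally show ?thesis .
qed

lemma mpoch_int_of_nat [simp]: "mpoch_int M (int n) = mpoch M n"
  by (simp add: mpoch_int_def)

text \<open>The sign in the definition disappears here, so that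
  \<open>(M)\<^bsub>-n\<^esub>\<close> becomes the inverse of a symbol whose factors can be
  telescoped against those of \<open>(M)\<^sub>k\<close>.\<close>
lemma mpoch_int_neg:
  fixes M :: "complex ^ 'd ^ 'd"
  assumes "\<And>k. k \<ge> 1 \<Longrightarrow> invertible (M - mat (of_nat k))"
  shows "mpoch_int M (- int n) = matrix_inv (mpoch (M - mat (of_nat n)) n)"
    "invertible (mpoch (M - mat (of_nat n)) n)"
proof -
  show inv: "invertible (mpoch (M - mat (of_nat n)) n)"
  proof (rule invertible_mpoch)
    fix k assume "k < n"
    then have "M - mat (of_nat n) + mat (of_nat k) = M - mat (of_nat (n - k))"
      by (simp add: vec_eq_iff mat_def of_nat_diff)
    then show "invertible (M - mat (of_nat n) + mat (of_nat k))"
      using assms[of "n - k"] \<open>k < n\<close> by (metis Suc_leI One_nat_def zero_less_diff)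
  qed
  have "matrix_inv (mscale ((-1) ^ n) (mpoch (M - mat (of_nat n)) n)) = mscale ((-1) ^ n) (matrix_inv (mpoch (M - mat (of_nat n)) n))"
    by (rule matrix_inv_eqI)
       (simp add: mscale_mult_left mscale_mult_right matrix_inv_cancel inv flip: power_mult_distrib)
  then show "mpoch_int M (- int n) = matrix_inv (mpoch (M - mat (of_nat n)) n)"
    by (cases "n = 0") (simp_all add: mpoch_int_def mpoch_reflect matrix_inv_eqI flip: power_mult_distrib)
qed

lemma mpoch_int_commute:
  fixes M :: "complex ^ 'd ^ 'd"
  assumes "\<And>k. k \<ge> 1 \<Longrightarrow> invertible (M - mat (of_nat k))" "M ** N = N ** M"
  shows "mpoch_int M p ** N = N ** mpoch_int M p"
proof (cases p rule: int_cases2)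
  case (nonneg n)
  then show ?thesis by (simp add: mpoch_commute assms)
next
  case (nonpos n)
  have "(M + mat (- of_nat n)) ** N = N ** (M + mat (- of_nat n))"
    by (rule commute_add_mat) fact
  moreover have "M - mat (of_nat n) = M + mat (- of_nat n)"
    by (simp add: vec_eq_iff mat_def)
  ultimately show ?thesis using mpoch_int_neg[OF assms(1), of n]
    by (metis nonpos matrix_inv_commute mpoch_commute)
qed

lemma invertible_add_sub_mat:
  fixes M :: "complex ^ 'd ^ 'd"
  assumes neg: "\<And>k. k \<ge> 1 \<Longrightarrow> invertible (M - mat (of_nat k))"
    and nonneg: "\<And>k. invertible (M + mat (of_nat k))"
  shows "invertible (M + mat (of_nat n) - mat (of_nat k))"
proof (cases "k \<le> n")
  case True
  then have "M + mat (of_nat n) - mat (of_nat k) = M + mat (of_nat (n - k))"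
    by (simp add: vec_eq_iff mat_def of_nat_diff)
  then show ?thesis by (simp only: nonneg)
next
  case False
  then have "M + mat (of_nat n) - mat (of_nat k) = M - mat (of_nat (k - n))"
    by (simp add: vec_eq_iff mat_def of_nat_diff)
  moreover have "k - n \<ge> 1" using False by simp
  ultimately show ?thesis by (simp only: neg)
qed

text \<open>For \<open>p = -j\<close> clear the two inverses: \<open>(M - j)\<^sub>j
  (M)\<^sub>n\<close> and \<open>(M - j)\<^sub>n (M - j + n)\<^sub>j\<close> are both the product
  \<open>(M - j)\<^bsub>n + j\<^esub>\<close>.\<close>
lemma mpoch_int_shift:
  fixes M :: "complex ^ 'd ^ 'd"
  assumes neg: "\<And>k. k \<ge> 1 \<Longrightarrow> invertible (M - mat (of_nat k))"
    and nonneg: "\<And>k. invertible (M + mat (of_nat k))"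
  shows "mpoch M n ** mpoch_int (M + mat (of_nat n)) p = mpoch (M + mat (of_int p)) n ** mpoch_int M p"
proof (cases p rule: int_cases2)
  case (nonneg k)
  then show ?thesis by (simp add: mpoch_shift)
next
  case (nonpos j)
  define P where "P = mpoch (M - mat (of_nat j)) j"
  define Q where "Q = mpoch (M + mat (of_nat n) - mat (of_nat j)) j"
  define R where "R = mpoch (M - mat (of_nat j)) n"
  have shifted: "invertible (M + mat (of_nat n) - mat (of_nat k))" for k
    using assms by (rule invertible_add_sub_mat)
  have P: "mpoch_int M p = matrix_inv P" "invertible P"
    using mpoch_int_neg[OF neg, of j] by (simp_all only: nonpos P_def)
  have Q: "mpoch_int (M + mat (of_nat n)) p = matrix_inv Q" "invertible Q"
    using mpoch_int_neg[OF shifted, of j] by (simp_all only: nonpos Q_def)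
  have "P ** mpoch M n = mpoch (M - mat (of_nat j)) (j + n)"
    by (simp add: mpoch_add P_def)
  also have "\<dots> = R ** Q"
  proof -
    have "M - mat (of_nat j) + mat (of_nat n) = M + mat (of_nat n) - mat (of_nat j)" by simp
    then show ?thesis unfolding add.commute[of j] mpoch_add R_def Q_def by (simp only:)
  qed
  finally have PR: "P ** mpoch M n = R ** Q" .
  have "matrix_inv P ** (P ** mpoch M n) ** matrix_inv Q = mpoch M n ** matrix_inv Q"
    by (simp add: matrix_mul_assoc matrix_inv_cancel P)
  moreover have "matrix_inv P ** (R ** Q) ** matrix_inv Q = matrix_inv P ** R"
    by (simp add: matrix_mul_assoc[symmetric] matrix_inv_cancel Q)
  moreover have "matrix_inv P ** R = R ** matrix_inv P"
    unfolding P_def R_def by (intro matrix_inv_commute P(2)[unfolded P_def] mpoch_commute_mpoch refl)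
  moreover have "M + mat (of_int p) = M - mat (of_nat j)"
    by (simp add: nonpos vec_eq_iff mat_def)
  ultimately show ?thesis
    unfolding P(1) Q(1) PR R_def by (simp only:)
qed

section \<open>Taylor series of a sum of holomorphic functions\<close>

text \<open>The sum may be differentiated term by term because its finite partial sums converge
  uniformly on compact sets; the limit is taken along the filter of finite index sets, so no
  enumeration of the index type is chosen.\<close>
lemma holomorphic_infsum:
  fixes g :: "'a \<Rightarrow> complex \<Rightarrow> complex"
  assumes U: "open U" and hol: "\<And>q. g q holomorphic_on U"
    and dom: "\<And>K. compact K \<Longrightarrow> K \<subseteq> U \<Longrightarrow> \<exists>b. b summable_on UNIV \<and> (\<forall>s\<in>K. \<forall>q. norm (g q s) \<le> b q)"
  shows "(\<lambda>s. \<Sum>\<^sub>\<infinity>q. g q s) holomorphic_on U"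
    and "z \<in> U \<Longrightarrow> ((\<lambda>q. (deriv ^^ n) (g q) z) has_sum (deriv ^^ n) (\<lambda>s. \<Sum>\<^sub>\<infinity>q. g q s) z) UNIV"
proof -
  let ?F = "finite_subsets_at_top (UNIV :: 'a set)"
  let ?L = "\<lambda>s. \<Sum>\<^sub>\<infinity>q. g q s"
  have ul: "uniform_limit K (\<lambda>X s. \<Sum>q\<in>X. g q s) ?L ?F" if K: "compact K" "K \<subseteq> U" for K
  proof -
    from dom[OF K] obtain b where "b summable_on UNIV" "\<forall>s\<in>K. \<forall>q. norm (g q s) \<le> b q" by blast
    then show ?thesis by (intro Weierstrass_m_test_general[where M = b]) auto
  qed
  have hol_sum: "(\<lambda>s. \<Sum>q\<in>X. g q s) holomorphic_on S" if "S \<subseteq> U" for X S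
    using hol that by (intro holomorphic_on_sum holomorphic_on_subset[OF hol])
  have cball: "\<exists>r>0. cball w r \<subseteq> U" if "w \<in> U" for w
    using U that by (simp add: open_contains_cball)
  show "?L holomorphic_on U"
  proof (rule analytic_imp_holomorphic, unfold analytic_on_def, intro ballI)
    fix w assume "w \<in> U"
    then obtain r where r: "r > 0" "cball w r \<subseteq> U" using cball by blast
    then have "ball w r \<subseteq> U" by auto
    have "?L holomorphic_on ball w r"
    proof (rule holomorphic_uniform_limit[of w r "\<lambda>X s. \<Sum>q\<in>X. g q s" ?F ?L])
      show "\<forall>\<^sub>F X in ?F. continuous_on (cball w r) (\<lambda>s. \<Sum>q\<in>X. g q s) \<and>
              (\<lambda>s. \<Sum>q\<in>X. g q s) holomorphic_on ball w r"
        by (intro always_eventually allI conjI holomorphic_on_imp_continuous_on hol_sum) fact+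
    qed (use ul[OF compact_cball r(2)] in auto)
    with r(1) show "\<exists>e>0. ?L holomorphic_on ball w e" by blast
  qed
  assume "z \<in> U"
  then obtain r where r: "r > 0" "cball z r \<subseteq> U" using cball by blast
  have "((\<lambda>X. (deriv ^^ n) (\<lambda>s. \<Sum>q\<in>X. g q s) z) \<longlongrightarrow> (deriv ^^ n) ?L z) ?F"
  proof (rule higher_deriv_complex_uniform_limit)
    show "uniform_limit (ball z r) (\<lambda>X s. \<Sum>q\<in>X. g q s) ?L ?F"
      by (rule uniform_limit_on_subset[OF ul[OF compact_cball r(2)]]) auto
    show "\<forall>\<^sub>F X in ?F. (\<lambda>s. \<Sum>q\<in>X. g q s) holomorphic_on ball z r"
      using r by (intro always_eventually allI hol_sum) auto
  qed (use r in auto)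
  moreover have "(deriv ^^ n) (\<lambda>s. \<Sum>q\<in>X. g q s) z = (\<Sum>q\<in>X. (deriv ^^ n) (g q) z)" for X
  proof (induction X rule: infinite_finite_induct)
    case (insert a X)
    have "(deriv ^^ n) (\<lambda>s. g a s + (\<Sum>q\<in>X. g q s)) z
        = (deriv ^^ n) (g a) z + (deriv ^^ n) (\<lambda>s. \<Sum>q\<in>X. g q s) z"
      by (rule higher_deriv_add[OF hol hol_sum U \<open>z \<in> U\<close>]) simp
    with insert show ?case by simp
  qed simp_all
  ultimately show "((\<lambda>q. (deriv ^^ n) (g q) z) has_sum (deriv ^^ n) ?L z) UNIV"
    by (simp add: has_sum_def)
qed

lemma higher_deriv_of_sums:
  assumes "r > 0" and f: "\<And>s. cmod s < r \<Longrightarrow> (\<lambda>n. a n * s ^ n) sums f s"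
  shows "f holomorphic_on ball 0 r" and "(deriv ^^ n) f 0 = fact n * a n"
proof -
  show hol: "f holomorphic_on ball 0 r"
    by (rule power_series_holomorphic[where a = a]) (use f in auto)
  have "f has_fps_expansion Abs_fps a"
  proof (rule has_fps_expansionI)
    show "\<forall>\<^sub>F u in nhds 0. (\<lambda>n. fps_nth (Abs_fps a) n * u ^ n) sums f u"
      using eventually_nhds_ball[OF \<open>r > 0\<close>, of 0] by eventually_elim (use f in auto)
  qed
  from fps_nth_fps_expansion[OF this, of n] show "(deriv ^^ n) f 0 = fact n * a n"
    by (simp add: field_simps)
qed

section \<open>Taylor series at the boundary of convergence\<close>

text \<open>Summation by parts expresses the difference of the two values as \<open>(1 -
  r)\<close> times the power series whose coefficients are the errors of the partial sums. The
  early errors are damped by \<open>1 - r\<close>, and the late ones are small.\<close>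
lemma Abel_limit:
  fixes a :: "nat \<Rightarrow> complex"
  assumes "a sums S"
  shows "((\<lambda>r. \<Sum>n. a n * of_real r ^ n) \<longlongrightarrow> S) (at_left 1)"
proof (rule tendstoI)
  fix e :: real assume "e > 0"
  \<comment> \<open>The errors of the partial sums; \<open>Suc n\<close> makes \<open>d n - d (n - 1)\<close> equal to \<open>a n\<close>.\<close>
  define d where "d = (\<lambda>n. (\<Sum>k<Suc n. a k) - S)"
  have d0: "d \<longlonglongrightarrow> 0"
    using assms[unfolded sums_def, THEN LIMSEQ_Suc] unfolding d_def by (rule LIM_zero)
  then have "\<exists>N. \<forall>n\<ge>N. cmod (d n) < e / 2"
    using \<open>e > 0\<close> unfolding LIMSEQ_iff diff_zero by (meson half_gt_zero)
  then obtain N where N: "\<And>n. n \<ge> N \<Longrightarrow> cmod (d n) < e / 2" by blast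
  define M where "M = (\<Sum>n<N. cmod (d n))"
  have bound: "cmod ((\<Sum>n. a n * of_real r ^ n) - S) \<le> (1 - r) * M + e / 2" if r: "0 < r" "r < 1" for r :: real
  proof -
    have "Bseq d" using d0 convergent_imp_Bseq convergent_def by blast
    then obtain B where B: "\<And>n. cmod (d n) \<le> B" "B > 0" by (auto simp: Bseq_def)
    have nsum: "summable (\<lambda>n. cmod (d n * of_real r ^ n))"
      by (rule summable_comparison_test'[where N = 0 and g = "\<lambda>n. B * r ^ n"])
         (use r B in \<open>auto simp: norm_mult norm_power intro!: mult_right_mono\<close>)
    then have sd: "summable (\<lambda>n. d n * of_real r ^ n)" by (rule summable_norm_cancel)
    have sg: "(\<lambda>n. of_real r ^ n :: complex) sums (1 / (1 - of_real r))"
      by (rule geometric_sums) (use r in simp)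
    have step: "a (Suc n) = d (Suc n) - d n" and a0: "a 0 = d 0 + S" for n
      by (simp_all add: d_def)
    have "(\<lambda>n. a (Suc n) * of_real r ^ Suc n) sums
        ((\<Sum>n. d n * of_real r ^ n) - d 0 - of_real r * (\<Sum>n. d n * of_real r ^ n))"
    proof -
      have "(\<lambda>n. d (Suc n) * of_real r ^ Suc n) sums ((\<Sum>n. d n * of_real r ^ n) - d 0)"
        using sd by (subst sums_Suc_iff) (simp add: summable_sums)
      moreover have "(\<lambda>n. of_real r * (d n * of_real r ^ n)) sums (of_real r * (\<Sum>n. d n * of_real r ^ n))"
        by (intro sums_mult summable_sums sd)
      ultimately have "(\<lambda>n. d (Suc n) * of_real r ^ Suc n - of_real r * (d n * of_real r ^ n)) sums
        ((\<Sum>n. d n * of_real r ^ n) - d 0 - of_real r * (\<Sum>n. d n * of_real r ^ n))"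
        by (rule sums_diff)
      then show ?thesis by (simp add: step algebra_simps)
    qed
    then have "(\<lambda>n. a n * of_real r ^ n) sums
        ((\<Sum>n. d n * of_real r ^ n) - d 0 - of_real r * (\<Sum>n. d n * of_real r ^ n) + a 0)"
      by (subst (asm) sums_Suc_iff) simp
    then have "(\<Sum>n. a n * of_real r ^ n) - S = of_real (1 - r) * (\<Sum>n. d n * of_real r ^ n)"
      by (simp add: sums_iff a0 algebra_simps)
    then have "cmod ((\<Sum>n. a n * of_real r ^ n) - S) = (1 - r) * cmod (\<Sum>n. d n * of_real r ^ n)"
      using r by (simp add: norm_mult del: of_real_diff)
    also have "\<dots> \<le> (1 - r) * (\<Sum>n. cmod (d n * of_real r ^ n))"
      using r by (intro mult_left_mono summable_norm nsum) auto
    also have "(\<Sum>n. cmod (d n * of_real r ^ n)) \<le> M + e / 2 * (1 / (1 - r))"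
    proof -
      have "(\<Sum>n. cmod (d n * of_real r ^ n)) \<le>
          (\<Sum>n. (if n < N then cmod (d n) else 0) + e / 2 * r ^ n)"
      proof (rule suminf_le)
        show "cmod (d n * of_real r ^ n) \<le> (if n < N then cmod (d n) else 0) + e / 2 * r ^ n" for n
        proof (cases "n < N")
          case True
          have "cmod (d n) * r ^ n \<le> cmod (d n)" using r by (intro mult_left_le power_le_one) auto
          moreover have "0 \<le> e / 2 * r ^ n" using r \<open>e > 0\<close> by auto
          ultimately show ?thesis using r True by (simp add: norm_mult norm_power)
        next
          case False
          then show ?thesis using N[of n] r by (auto simp: norm_mult norm_power intro!: mult_right_mono)
        qed
        show "summable (\<lambda>n. (if n < N then cmod (d n) else 0) + e / 2 * r ^ n)"
          by (intro summable_add summable_mult summable_geometric summable_finite[of "{..<N}"]) (use r in auto)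
      qed fact
      also have "\<dots> = M + e / 2 * (1 / (1 - r))"
      proof (rule sums_unique[symmetric], rule sums_add)
        show "(\<lambda>n. if n < N then cmod (d n) else 0) sums M"
          using sums_If_finite_set[of "{..<N}" "\<lambda>n. cmod (d n)"] by (simp add: M_def)
        show "(\<lambda>n. e / 2 * r ^ n) sums (e / 2 * (1 / (1 - r)))"
          by (intro sums_mult geometric_sums) (use r in auto)
      qed
      finally show ?thesis .
    qed
    then have "(1 - r) * (\<Sum>n. cmod (d n * of_real r ^ n)) \<le> (1 - r) * (M + e / 2 * (1 / (1 - r)))"
      using r by (intro mult_left_mono) auto
    also have "\<dots> = (1 - r) * M + e / 2"
    proof -
      have "(1 - r) * (1 / (1 - r)) = 1" using r by simp
      then show ?thesis unfolding distrib_left mult.left_commute[of "1 - r" "e / 2"] by simp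
    qed
    finally show ?thesis .
  qed
  have "((\<lambda>r. (1 - r) * M + e / 2) \<longlongrightarrow> (1 - 1) * M + e / 2) (at_left (1::real))"
    by (intro tendsto_intros)
  then have "\<forall>\<^sub>F r in at_left (1::real). (1 - r) * M + e / 2 < e"
    by (rule order_tendstoD(2)) (use \<open>e > 0\<close> in simp)
  moreover have "\<forall>\<^sub>F r in at_left (1::real). 0 < r \<and> r < 1"
    by (auto intro!: eventually_at_leftI[of 0])
  ultimately show "\<forall>\<^sub>F r in at_left 1. dist (\<Sum>n. a n * of_real r ^ n) S < e"
  proof eventually_elim
    case (elim r)
    then show ?case using bound[of r] unfolding dist_norm by linarith
  qed
qed

text \<open>Convergence at \<open>t\<close> makes the Taylor series of \<open>f\<close> converge
  in the disc \<open>\<bar>s\<bar> < \<bar>t\<bar>\<close>, even where that disc leaves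
  \<open>U\<close>. Near the origin its sum is \<open>f\<close>, hence it is \<open>f\<close> on
  the connected set \<open>U \<inter> ball 0 \<bar>t\<bar>\<close>. The last part of the radius to
  \<open>t\<close> lies in that set, and Abel's limit theorem carries the equality to
  \<open>t\<close> itself. The radius as a whole may leave \<open>U\<close>, which is why
  continuation along it would not do.\<close>
lemma Taylor_sums_at_boundary:
  fixes f :: "complex \<Rightarrow> complex"
  assumes U: "open U" "0 \<in> U" "t \<in> U" and conn: "connected (U \<inter> ball 0 (cmod t))"
    and f: "f holomorphic_on U"
    and summ: "summable (\<lambda>n. (deriv ^^ n) f 0 / fact n * t ^ n)"
  shows "(\<lambda>n. (deriv ^^ n) f 0 / fact n * t ^ n) sums f t"
proof (cases "t = 0")
  case True
  have "(\<lambda>n. (deriv ^^ n) f 0 / fact n * 0 ^ n) sums f 0"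
    using powser_sums_zero[of "\<lambda>n. (deriv ^^ n) f 0 / fact n"] by simp
  then show ?thesis by (simp add: True)
next
  case False
  define c where "c = (\<lambda>n. (deriv ^^ n) f 0 / fact n)"
  define F where "F = (\<lambda>s. \<Sum>n. c n * s ^ n)"
  have F: "(\<lambda>n. c n * s ^ n) sums F s" if "cmod s < cmod t" for s
    unfolding F_def
    by (rule summable_sums, rule powser_inside[where x = t]) (use summ that in \<open>simp_all add: c_def\<close>)
  have Fhol: "F holomorphic_on ball 0 (cmod t)"
    by (rule higher_deriv_of_sums(1)[where a = c]) (use F False in auto)
  obtain r where r: "r > 0" "ball 0 r \<subseteq> U"
    using U by (auto simp: open_contains_ball)
  define r' where "r' = min r (cmod t)"
  have r': "r' > 0" "ball 0 r' \<subseteq> U \<inter> ball 0 (cmod t)"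
    using r False by (auto simp: r'_def)
  have eq: "f s = F s" if "s \<in> U \<inter> ball 0 (cmod t)" for s
  proof (rule analytic_continuation_open[of "ball 0 r'" "U \<inter> ball 0 (cmod t)" f F])
    fix s :: complex assume s: "s \<in> ball 0 r'"
    have "(\<lambda>n. (deriv ^^ n) f 0 / fact n * (s - 0) ^ n) sums f s"
      using s r'(2) by (intro holomorphic_power_series[where r = r'] holomorphic_on_subset[OF f]) auto
    then show "f s = F s" by (simp add: F_def sums_iff c_def)
  next
    show "f holomorphic_on U \<inter> ball 0 (cmod t)" "F holomorphic_on U \<inter> ball 0 (cmod t)"
      by (rule holomorphic_on_subset[OF f] holomorphic_on_subset[OF Fhol], simp)+
    show "open (U \<inter> ball 0 (cmod t))" using U by auto
  qed (use r' conn that in auto)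
  have lim1: "((\<lambda>r. F (of_real r * t)) \<longlongrightarrow> (\<Sum>n. c n * t ^ n)) (at_left 1)"
    using Abel_limit[of "\<lambda>n. c n * t ^ n" "\<Sum>n. c n * t ^ n"] summ
    by (simp add: F_def c_def summable_sums power_mult_distrib mult_ac)
  have rt: "((\<lambda>r. of_real r * t) \<longlongrightarrow> t) (at_left (1::real))"
    using tendsto_mult_right[OF tendsto_of_real[OF tendsto_ident_at], of t "1::real" "{..<1}"] by simp
  have "isCont f t"
    using holomorphic_on_imp_continuous_on[OF f] U by (simp add: continuous_on_eq_continuous_at)
  then have lim2: "((\<lambda>r. f (of_real r * t)) \<longlongrightarrow> f t) (at_left (1::real))"
    using rt by (rule isCont_tendsto_compose)
  have "\<forall>\<^sub>F r in at_left (1::real). of_real r * t \<in> U"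
    by (rule topological_tendstoD[OF rt U(1,3)])
  moreover have "\<forall>\<^sub>F r in at_left (1::real). 0 < r \<and> r < 1"
    by (auto intro!: eventually_at_leftI[of 0])
  ultimately have "\<forall>\<^sub>F r in at_left (1::real). f (of_real r * t) = F (of_real r * t)"
    by eventually_elim (rule eq, use False in \<open>auto simp: norm_mult\<close>)
  then have "((\<lambda>r. F (of_real r * t)) \<longlongrightarrow> f t) (at_left 1)"
    by (rule Lim_transform_eventually[OF lim2])
  then have "f t = (\<Sum>n. c n * t ^ n)"
    using lim1 by (intro tendsto_unique) auto
  then show ?thesis using summ by (simp add: c_def summable_sums)
qed

text \<open>A disc about \<open>0\<close> from which a disc about \<open>1\<close> has been
  removed. Its part with \<open>\<bar>s\<bar> \<le> r\<close> is star-shaped about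
  \<open>-r\<close>, because the distance to \<open>1\<close> does not decrease on the way from
  \<open>s\<close> to \<open>-r\<close>; these parts all contain \<open>0\<close> and exhaust the
  set.\<close>
lemma connected_ball_minus_cball:
  assumes c: "0 \<le> c" "c < 1" and \<rho>: "\<rho> \<le> 1"
  shows "connected {s :: complex. cmod s < \<rho> \<and> c < cmod (1 - s)}"
proof -
  define S where "S = (\<lambda>r. {s :: complex. cmod s \<le> r \<and> c < cmod (1 - s)})"
  have conn: "connected (S r)" if r: "0 \<le> r" "r < 1" for r
  proof (rule starlike_imp_connected, unfold starlike_def, intro bexI ballI)
    show "- of_real r \<in> S r"
    proof -
      have "cmod (1 + of_real r) = 1 + r" using r norm_of_real[of "1 + r", where 'a = complex] by simp
      then show ?thesis using r c by (simp add: S_def)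
    qed
    fix s assume s: "s \<in> S r"
    show "closed_segment (- of_real r) s \<subseteq> S r"
    proof
      fix z assume z: "z \<in> closed_segment (- of_real r) s"
      have "z \<in> cball 0 r"
        using z s r closed_segment_subset[of "- of_real r" "cball 0 r" s] by (auto simp: S_def)
      moreover have "c < cmod (1 - z)"
      proof -
        obtain u where u: "0 \<le> u" "u \<le> 1" and zu: "z = s + of_real u * (- of_real r - s)"
          using z closed_segment_commute[of "- of_real r" s]
          by (auto simp: closed_segment_def scaleR_conv_of_real algebra_simps)
        define a b where "a = Re s" and "b = Im s"
        have ab: "a\<^sup>2 + b\<^sup>2 \<le> r\<^sup>2"
          using power_mono[of "cmod s" r 2] s by (simp add: S_def cmod_power2 a_def b_def)
        have "\<bar>a\<bar> \<le> r" using abs_Re_le_cmod[of s] s by (auto simp: a_def S_def)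
        \<comment> \<open>The inner product of \<open>s - 1\<close> and \<open>-r - s\<close>: the segment starts away from \<open>1\<close>.\<close>
        have inner: "0 \<le> (1 - a) * (r + a) - b\<^sup>2"
        proof -
          have "0 \<le> (1 - r) * (r + a)" using r \<open>\<bar>a\<bar> \<le> r\<close> by (intro mult_nonneg_nonneg) auto
          then show ?thesis using ab by (simp add: algebra_simps power2_eq_square)
        qed
        have "(cmod (1 - z))\<^sup>2 = (1 - a + u * (r + a))\<^sup>2 + (b - u * b)\<^sup>2"
          unfolding cmod_power2 by (simp add: zu a_def b_def algebra_simps power2_commute)
        also have "\<dots> = (1 - a)\<^sup>2 + b\<^sup>2 + 2 * u * ((1 - a) * (r + a) - b\<^sup>2) + u\<^sup>2 * ((r + a)\<^sup>2 + b\<^sup>2)"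
          by (simp add: algebra_simps power2_eq_square)
        also have "\<dots> \<ge> (1 - a)\<^sup>2 + b\<^sup>2"
          using u inner by simp
        finally have "(cmod (1 - s))\<^sup>2 \<le> (cmod (1 - z))\<^sup>2"
          by (simp add: cmod_power2 a_def b_def)
        then have "cmod (1 - s) \<le> cmod (1 - z)" by (rule power2_le_imp_le) simp
        then show ?thesis using s by (simp add: S_def)
      qed
      ultimately show "z \<in> S r" by (simp add: S_def)
    qed
  qed
  have "{s :: complex. cmod s < \<rho> \<and> c < cmod (1 - s)} = \<Union> (S ` {0..<\<rho>})"
  proof (intro equalityI subsetI)
    fix s assume "s \<in> {s :: complex. cmod s < \<rho> \<and> c < cmod (1 - s)}"
    then have "s \<in> S (cmod s)" "cmod s \<in> {0..<\<rho>}" by (auto simp: S_def)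
    then show "s \<in> \<Union> (S ` {0..<\<rho>})" by blast
  qed (auto simp: S_def)
  moreover have "connected (\<Union> (S ` {0..<\<rho>}))"
  proof (rule connected_Union)
    have "0 \<in> \<Inter> (S ` {0..<\<rho>})" using c by (auto simp: S_def)
    then show "\<Inter> (S ` {0..<\<rho>}) \<noteq> {}" by blast
  qed (use conn \<rho> in auto)
  ultimately show ?thesis by simp
qed

section \<open>Growth of Pochhammer symbols and of the coefficients\<close>

lemma summable_on_product:
  fixes f g :: "nat \<Rightarrow> real"
  assumes "summable f" "summable g" "\<And>n. 0 \<le> f n" "\<And>n. 0 \<le> g n"
  shows "(\<lambda>(m, n). f m * g n) summable_on UNIV"
proof -
  have f: "f summable_on UNIV" and g: "g summable_on UNIV"
    using assms by (simp_all add: summable_on_UNIV_nonneg_real_iff)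
  have "(\<lambda>(m, n). f m * g n) summable_on (UNIV \<times> UNIV)"
  proof (rule summable_on_SigmaI)
    show "((\<lambda>n. case (m, n) of (m, n) \<Rightarrow> f m * g n) has_sum f m * infsum g UNIV) UNIV" for m
      using g by (auto intro!: has_sum_cmult_right)
    show "(\<lambda>m. f m * infsum g UNIV) summable_on UNIV"
      using f by (rule summable_on_cmult_left)
  qed (use assms in auto)
  then show ?thesis by simp
qed

lemma ratio_growth:
  fixes h :: "nat \<Rightarrow> real"
  assumes "q > 0" "\<And>n. 0 \<le> h n" "\<forall>\<^sub>F n in sequentially. h (Suc n) \<le> q * h n"
  obtains K where "0 \<le> K" "\<And>n. h n \<le> K * q ^ n"
proof -
  obtain N where N: "\<And>n. n \<ge> N \<Longrightarrow> h (Suc n) \<le> q * h n"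
    using assms(3) by (auto simp: eventually_sequentially)
  define K where "K = (\<Sum>n\<le>N. h n / q ^ n)"
  have K0: "h n \<le> K * q ^ n" if "n \<le> N" for n
  proof -
    have "h n / q ^ n \<le> K"
      unfolding K_def using assms that by (intro member_le_sum) auto
    then show ?thesis using assms(1) by (simp add: field_simps)
  qed
  have "h n \<le> K * q ^ n" for n
  proof (induction n)
    case 0
    show ?case using K0[of 0] by simp
  next
    case (Suc n)
    show ?case
    proof (cases "Suc n \<le> N")
      case False
      then have "h (Suc n) \<le> q * h n" using N by simp
      also have "\<dots> \<le> q * (K * q ^ n)" using Suc assms(1) by (intro mult_left_mono) auto
      finally show ?thesis by (simp add: mult_ac)
    qed (rule K0)
  qed
  moreover have "0 \<le> K" unfolding K_def using assms by (intro sum_nonneg) auto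
  ultimately show thesis using that by blast
qed

text \<open>The left side is one term of the binomial expansion of \<open>((1 - r) + r)\<^bsup>m +
  k\<^esup> = 1\<close>, divided by its powers. This bound separates \<open>m\<close> from
  \<open>k\<close> while \<open>1 / r\<close> stays as close to \<open>1\<close> as desired, which
  is what lets the double series converge for every \<open>\<bar>y\<bar> < 1\<close>.\<close>
lemma choose_le_geometric:
  fixes r :: real
  assumes "0 < r" "r < 1"
  shows "real ((m + k) choose m) \<le> (1 / (1 - r)) ^ m * (1 / r) ^ k"
proof -
  have "1 = ((1 - r) + r) ^ (m + k)" by simp
  also have "\<dots> = (\<Sum>i\<le>m + k. real ((m + k) choose i) * (1 - r) ^ i * r ^ (m + k - i))"
    by (simp only: binomial_ring)
  also have "\<dots> \<ge> real ((m + k) choose m) * (1 - r) ^ m * r ^ (m + k - m)"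
    using assms by (intro member_le_sum) auto
  finally show ?thesis using assms by (simp add: field_simps)
qed

lemma invertible_mscale:
  fixes M :: "complex ^ 'd ^ 'd"
  assumes "invertible M" "c \<noteq> 0"
  shows "invertible (mscale c M)"
  unfolding invertible_def
  by (rule exI[of _ "mscale (1 / c) (matrix_inv M)"])
     (use assms in \<open>simp add: mscale_mult_left mscale_mult_right matrix_inv_cancel\<close>)

lemma matrix_mult_norm_bound:
  obtains k where "k > 0" "\<And>(M :: complex ^ 'd ^ 'd) (N :: complex ^ 'd ^ 'd). norm (M ** N) \<le> norm M * norm N * k"
  using bounded_bilinear.pos_bounded[OF bounded_bilinear_matrix_mult] by blast

text \<open>Up to the factor \<open>q ^ n\<close>, with \<open>q\<close> as close to
  \<open>1\<close> as desired, a matrix Pochhammer symbol grows like that of the number 1: the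
  ratio of consecutive symbols is \<open>M + nI\<close>, and for large \<open>n\<close>
  multiplication by it enlarges norms by a factor of at most \<open>q (n + 1)\<close>. Such crude
  geometric losses are harmless inside an open region of convergence.\<close>
lemma mpoch_growth:
  fixes M :: "complex ^ 'd ^ 'd"
  assumes "q > 1"
  obtains K where "0 \<le> K" "\<And>n. norm (mpoch M n) \<le> K * q ^ n * fact n"
proof -
  obtain k where k: "k > 0" "\<And>(M :: complex ^ 'd ^ 'd) (N :: complex ^ 'd ^ 'd). norm (M ** N) \<le> norm M * norm N * k"
    using matrix_mult_norm_bound by blast
  define a where "a = norm M * k"
  have "\<forall>\<^sub>F n in sequentially. real n \<ge> a / (q - 1)"
    using eventually_ge_at_top[of "nat \<lceil>a / (q - 1)\<rceil>"] by eventually_elim linarith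
  then have ev: "\<forall>\<^sub>F n in sequentially. norm (mpoch M (Suc n)) / fact (Suc n) \<le> q * (norm (mpoch M n) / fact n)"
  proof eventually_elim
    case (elim n)
    then have "real n + a \<le> q * (real n + 1)" using assms by (simp add: field_simps)
    have "norm (mpoch M (Suc n)) \<le> norm (mpoch M n ** M) + norm (mpoch M n ** mat (of_nat n))"
      by (simp add: matrix_add_ldistrib norm_triangle_ineq)
    also have "\<dots> \<le> (real n + a) * norm (mpoch M n)"
      using k(2)[of "mpoch M n" M] by (simp add: mat_mult_right norm_mscale a_def algebra_simps)
    also have "\<dots> \<le> q * (real n + 1) * norm (mpoch M n)"
      by (rule mult_right_mono) (fact, simp)
    finally have "norm (mpoch M (Suc n)) \<le> q * norm (mpoch M n) / fact n * fact (Suc n)"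
      by (simp add: mult_ac add.commute[of 1])
    then show ?case by (simp only: pos_divide_le_eq fact_gt_zero times_divide_eq_right)
  qed
  obtain K where "0 \<le> K" "\<And>n. norm (mpoch M n) / fact n \<le> K * q ^ n"
    by (rule ratio_growth[OF _ _ ev]) (use assms in auto)
  then show thesis using that[of K] by (simp add: field_simps)
qed

text \<open>As for the symbols themselves, now with the ratio \<open>(M +
  nI)\<^bsup>-1\<^esup>\<close>, which for large \<open>n\<close> multiplies norms by at most
  \<open>q / (n + 1)\<close>.\<close>
lemma inverse_mpoch_growth:
  fixes M :: "complex ^ 'd ^ 'd"
  assumes "q > 1" and inv: "\<And>k. invertible (M + mat (of_nat k))"
  obtains K where "0 \<le> K" "\<And>n. norm (matrix_inv (mpoch M n)) \<le> K * q ^ n / fact n"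
proof -
  obtain k where k: "k > 0" "\<And>(M :: complex ^ 'd ^ 'd) (N :: complex ^ 'd ^ 'd). norm (M ** N) \<le> norm M * norm N * k"
    using matrix_mult_norm_bound by blast
  define a where "a = norm M * k"
  define R where "R = (\<lambda>n. matrix_inv (mpoch M n))"
  have step: "(M + mat (of_nat n)) ** R (Suc n) = R n" for n
  proof -
    have "R n = R n ** (mpoch M (Suc n) ** R (Suc n))"
      unfolding R_def by (simp only: matrix_inv_cancel invertible_mpoch inv matrix_mul_rid)
    also have "\<dots> = R n ** mpoch M n ** ((M + mat (of_nat n)) ** R (Suc n))"
      by (simp add: matrix_mul_assoc)
    also have "R n ** mpoch M n = mat 1"
      unfolding R_def by (simp only: matrix_inv_cancel invertible_mpoch inv)
    finally show ?thesis by simp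
  qed
  have "\<forall>\<^sub>F n in sequentially. real n \<ge> (1 + q * a) / (q - 1)"
    using eventually_ge_at_top[of "nat \<lceil>(1 + q * a) / (q - 1)\<rceil>"] by eventually_elim linarith
  then have ev: "\<forall>\<^sub>F n in sequentially. norm (R (Suc n)) * fact (Suc n) \<le> q * (norm (R n) * fact n)"
  proof eventually_elim
    case (elim n)
    then have n: "real n + 1 \<le> q * (real n - a)" using assms by (simp add: field_simps)
    have "mscale (of_nat n) (R (Suc n)) = R n - M ** R (Suc n)"
      by (simp flip: step[of n] add: matrix_add_rdistrib mat_mult_left)
    then have "real n * norm (R (Suc n)) \<le> norm (R n) + norm (M ** R (Suc n))"
      by (metis norm_mscale norm_of_nat norm_triangle_ineq4)
    also have "norm (M ** R (Suc n)) \<le> a * norm (R (Suc n))"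
      using k(2)[of M "R (Suc n)"] by (simp add: a_def mult_ac)
    finally have "(real n - a) * norm (R (Suc n)) \<le> norm (R n)" by (simp add: algebra_simps)
    then have "q * ((real n - a) * norm (R (Suc n))) \<le> q * norm (R n)"
      using assms by (intro mult_left_mono) auto
    moreover have "(real n + 1) * norm (R (Suc n)) \<le> q * (real n - a) * norm (R (Suc n))"
      by (rule mult_right_mono) (fact, simp)
    ultimately have "(real n + 1) * norm (R (Suc n)) \<le> q * norm (R n)" by (simp add: mult_ac)
    then have "(real n + 1) * norm (R (Suc n)) * fact n \<le> q * norm (R n) * fact n"
      by (rule mult_right_mono) simp
    then show ?case by (simp add: algebra_simps)
  qed
  obtain K where "0 \<le> K" "\<And>n. norm (R n) * fact n \<le> K * q ^ n"
    by (rule ratio_growth[OF _ _ ev]) (use assms in auto)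
  then show thesis using that[of K] by (simp add: field_simps R_def)
qed

lemma mpoch_int_growth:
  fixes M :: "complex ^ 'd ^ 'd"
  assumes "q > 1" and neg: "\<And>k. k \<ge> 1 \<Longrightarrow> invertible (M - mat (of_nat k))"
  obtains K where "0 \<le> K" "\<And>m k. norm (mpoch_int M (int m - int k)) \<le>
      K * q ^ (m + k) * (if k \<le> m then fact (m - k) else 1 / fact (k - m))"
proof -
  obtain K1 where K1: "0 \<le> K1" "\<And>n. norm (mpoch M n) \<le> K1 * q ^ n * fact n"
    using mpoch_growth[OF assms(1)] by blast
  have "invertible (mat 1 - M + mat (of_nat k))" for k
  proof -
    have "mat 1 - M + mat (of_nat k) = mscale (-1) (M - mat (of_nat (Suc k)))"
      by (simp add: vec_eq_iff mat_def)
    then show ?thesis using neg[of "Suc k"] by (simp add: invertible_mscale)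
  qed
  then obtain K2 where K2: "0 \<le> K2" "\<And>n. norm (matrix_inv (mpoch (mat 1 - M) n)) \<le> K2 * q ^ n / fact n"
    using inverse_mpoch_growth[OF assms(1), of "mat 1 - M"] by blast
  show thesis
  proof (rule that[of "max K1 K2"])
    show "0 \<le> max K1 K2" using K1 by simp
    fix m k
    show "norm (mpoch_int M (int m - int k)) \<le>
      max K1 K2 * q ^ (m + k) * (if k \<le> m then fact (m - k) else 1 / fact (k - m))"
    proof (cases "k \<le> m")
      case True
      then have "norm (mpoch_int M (int m - int k)) = norm (mpoch M (m - k))"
        using mpoch_int_of_nat[of M "m - k"] by (simp add: of_nat_diff)
      also have "\<dots> \<le> K1 * q ^ (m - k) * fact (m - k)" by (rule K1)
      also have "\<dots> \<le> max K1 K2 * q ^ (m + k) * fact (m - k)"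
        using assms(1) K1 by (intro mult_mono power_increasing) auto
      finally show ?thesis using True by simp
    next
      case False
      then have "nat (- (int m - int k)) = k - m" by simp
      then have "norm (mpoch_int M (int m - int k)) = norm (matrix_inv (mpoch (mat 1 - M) (k - m)))"
        using False by (simp add: mpoch_int_def norm_mscale norm_power)
      also have "\<dots> \<le> K2 * q ^ (k - m) / fact (k - m)" by (rule K2)
      also have "\<dots> \<le> max K1 K2 * q ^ (m + k) / fact (k - m)"
        using assms(1) K1 by (intro divide_right_mono mult_mono power_increasing) auto
      finally show ?thesis using False by simp
    qed
  qed
qed

definition H11_coeff :: "complex ^ 'd ^ 'd \<Rightarrow> complex ^ 'd ^ 'd \<Rightarrow> complex ^ 'd ^ 'd \<Rightarrow>
    complex ^ 'd ^ 'd \<Rightarrow> nat \<times> nat \<Rightarrow> complex ^ 'd ^ 'd" where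
  "H11_coeff A B C C' = (\<lambda>(m, k). mscale (1 / (fact m * fact k))
     (mpoch_int A (int m - int k) ** mpoch B k ** mpoch C k ** matrix_inv (mpoch C' m)))"

text \<open>The factorials that remain after all Pochhammer symbols in a coefficient have been
  replaced by their growth, apart from one factor \<open>1 / m!\<close>. For \<open>k \<le>
  m\<close> the quotient is an inverse binomial coefficient, for \<open>k > m\<close> it is
  \<open>k choose m\<close>.\<close>
lemma fact_quotient_le_choose:
  "(if k \<le> m then fact (m - k) else 1 / fact (k - m)) * fact k / fact m \<le> real ((m + k) choose m)"
proof (cases "k \<le> m")
  case True
  have "fact k * fact (m - k) \<le> (fact m :: real)"
    using binomial_fact_lemma[OF True] True
    by (metis (mono_tags) binomial_eq_0_iff le_add2 mult.right_neutral mult_le_mono2 not_less of_nat_fact of_nat_le_iff of_nat_mult One_nat_def Suc_leI zero_less_iff_neq_zero)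
  then have "fact (m - k) * fact k / fact m \<le> (1 :: real)" by (simp add: mult_ac)
  also have "1 \<le> real ((m + k) choose m)" by (simp add: Suc_leI)
  finally show ?thesis using True by simp
next
  case False
  then have "1 / fact (k - m) * fact k / fact m = real (k choose m)"
    by (simp add: binomial_fact mult_ac)
  also have "k choose m \<le> (m + k) choose m"
    by (rule binomial_right_mono) simp
  finally show ?thesis using False by simp
qed

text \<open>The coefficient of \<open>x ^ m y ^ k\<close> is at most a constant times
  \<open>(q\<^sup>2) ^ m (q\<^sup>3) ^ k ((m + k) choose m) / m!\<close>. Separating
  \<open>m\<close> from \<open>k\<close> leaves an exponential series in \<open>x\<close> and a
  geometric series in \<open>y\<close>.\<close>
lemma H11_majorant_summable:
  fixes A B C C' :: "complex ^ 'd ^ 'd" and X Y :: real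
  assumes C': "\<And>k::nat. invertible (C' + mat (of_nat k))"
    and A: "\<And>k::nat. k \<ge> 1 \<Longrightarrow> invertible (A - mat (of_nat k))"
    and X: "0 \<le> X" and Y: "0 \<le> Y" "Y < 1"
  shows "(\<lambda>(m, k). X ^ m * Y ^ k * norm (H11_coeff A B C C' (m, k))) summable_on UNIV"
proof -
  \<comment> \<open>\<open>r\<close> leaves room between \<open>Y\<close> and \<open>1\<close>; the exponent 3 below counts the factors \<open>q ^ k\<close> lost in the bounds.\<close>
  obtain r where r: "Y < r" "r < 1" using Y dense by blast
  with Y have "0 < r" by simp
  have "((\<lambda>q. q ^ 3 * Y) \<longlongrightarrow> 1 ^ 3 * Y) (at_right (1::real))"
    by (intro tendsto_intros)
  then have "\<forall>\<^sub>F q in at_right (1::real). q ^ 3 * Y < r"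
    by (rule order_tendstoD(2)) (use r in simp)
  moreover have "\<forall>\<^sub>F q in at_right (1::real). 1 < q"
    by (simp add: eventually_at_right_less)
  ultimately have "\<forall>\<^sub>F q in at_right (1::real). q ^ 3 * Y < r \<and> 1 < q"
    by eventually_elim simp
  then obtain q :: real where q: "q ^ 3 * Y < r" "1 < q"
    using eventually_happens[of _ "at_right (1::real)"] by auto
  obtain k0 where k0: "k0 > 0" "\<And>(M :: complex ^ 'd ^ 'd) (N :: complex ^ 'd ^ 'd). norm (M ** N) \<le> norm M * norm N * k0"
    using matrix_mult_norm_bound by blast
  define w where "w = (\<lambda>m k. if k \<le> m then fact (m - k) else 1 / fact (k - m) :: real)"
  obtain K1 where K1: "0 \<le> K1" "\<And>m k. norm (mpoch_int A (int m - int k)) \<le> K1 * q ^ (m + k) * w m k"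
    using mpoch_int_growth[OF q(2) A] unfolding w_def by blast
  obtain K2 where K2: "0 \<le> K2" "\<And>n. norm (mpoch B n) \<le> K2 * q ^ n * fact n"
    using mpoch_growth[OF q(2)] by blast
  obtain K3 where K3: "0 \<le> K3" "\<And>n. norm (mpoch C n) \<le> K3 * q ^ n * fact n"
    using mpoch_growth[OF q(2)] by blast
  obtain K4 where K4: "0 \<le> K4" "\<And>n. norm (matrix_inv (mpoch C' n)) \<le> K4 * q ^ n / fact n"
    using inverse_mpoch_growth[OF q(2) C'] by blast
  define K where "K = K1 * K2 * K3 * K4 * k0 ^ 3"
  have K: "0 \<le> K" using K1 K2 K3 K4 k0 by (simp add: K_def)
  have w0: "0 \<le> w m k" for m k by (simp add: w_def)
  define F where "F = (\<lambda>m. K * ((q\<^sup>2 * X / (1 - r)) ^ m / fact m))"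
  define G where "G = (\<lambda>k. (q ^ 3 * Y / r) ^ k)"
  have bound: "X ^ m * Y ^ k * norm (H11_coeff A B C C' (m, k)) \<le> F m * G k" for m k
  proof -
    have "norm (mpoch_int A (int m - int k) ** mpoch B k ** mpoch C k ** matrix_inv (mpoch C' m))
      \<le> norm (mpoch_int A (int m - int k)) * norm (mpoch B k) * k0 * norm (mpoch C k) * k0
          * norm (matrix_inv (mpoch C' m)) * k0"
      using k0(1) by (intro order_trans[OF k0(2)] mult_right_mono norm_ge_zero less_imp_le[OF k0(1)] order_refl)
    also have "\<dots> \<le> (K1 * q ^ (m + k) * w m k) * (K2 * q ^ k * fact k) * k0 * (K3 * q ^ k * fact k) * k0
          * (K4 * q ^ m / fact m) * k0"
      using k0(1) q K1 K2 K3 K4 w0 by (intro mult_mono K1 K2 K3 K4 order_refl) simp_all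
    also have "\<dots> = K * (q\<^sup>2) ^ m * (q ^ 3) ^ k * fact k * (w m k * fact k / fact m)"
      by (simp add: K_def power_add power_mult[symmetric] mult_2 power2_eq_square power3_eq_cube power_mult_distrib)
    also have "\<dots> \<le> K * (q\<^sup>2) ^ m * (q ^ 3) ^ k * fact k * ((1 / (1 - r)) ^ m * (1 / r) ^ k)"
      using K q fact_quotient_le_choose[of k m, folded w_def] choose_le_geometric[OF \<open>0 < r\<close> r(2), of m k]
      by (intro mult_left_mono) (simp_all add: w_def)
    finally have "norm (mpoch_int A (int m - int k) ** mpoch B k ** mpoch C k ** matrix_inv (mpoch C' m))
      \<le> K * (q\<^sup>2) ^ m * (q ^ 3) ^ k * fact k * ((1 / (1 - r)) ^ m * (1 / r) ^ k)" .
    then have "X ^ m * Y ^ k * norm (H11_coeff A B C C' (m, k)) \<le> X ^ m * Y ^ k * (1 / (fact m * fact k) *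
       (K * (q\<^sup>2) ^ m * (q ^ 3) ^ k * fact k * ((1 / (1 - r)) ^ m * (1 / r) ^ k)))"
      using X Y unfolding H11_coeff_def prod.case norm_mscale
      by (intro mult_left_mono mult_mono) (simp_all add: norm_divide norm_mult)
    also have "\<dots> = F m * G k"
      by (simp add: F_def G_def power_mult_distrib power_divide field_simps)
    finally show ?thesis .
  qed
  have "(\<lambda>(m, k). F m * G k) summable_on UNIV"
  proof (rule summable_on_product)
    show "summable F" unfolding F_def
      by (intro summable_mult) (simp add: summable_exp_generic[of "_ :: real", simplified] summable_exp divide_inverse mult.commute)
    show "summable G" unfolding G_def
      using q Y r \<open>0 < r\<close> by (intro summable_geometric) (simp add: abs_mult)
  qed (use K X Y q r \<open>0 < r\<close> in \<open>simp_all add: F_def G_def\<close>)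
  moreover have "(case p of (m, k) \<Rightarrow> X ^ m * Y ^ k * norm (H11_coeff A B C C' (m, k))) \<le> (case p of (m, k) \<Rightarrow> F m * G k)" for p
    by (cases p) (use bound in auto)
  moreover have "0 \<le> (case p of (m, k) \<Rightarrow> X ^ m * Y ^ k * norm (H11_coeff A B C C' (m, k)))" for p
    using X Y by (cases p) auto
  ultimately show ?thesis
    using summable_on_comparison_test[of "\<lambda>(m, k). F m * G k" UNIV] by blast
qed

section \<open>The matrix binomial series\<close>

lemma mbinom_sums:
  fixes M :: "complex ^ 'd ^ 'd"
  assumes "cmod t < 1"
  shows "(\<lambda>n. mscale (t ^ n / fact n) (mpoch M n)) sums mbinom t M"
proof -
  obtain r where r: "cmod t < r" "r < 1" using assms dense by blast
  then have "0 < r" using norm_ge_zero[of t] by linarith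
  then obtain K where K: "0 \<le> K" "\<And>n. norm (mpoch M n) \<le> K * (1 / r) ^ n * fact n"
    using mpoch_growth[of "1 / r" M] r by auto
  have "summable (\<lambda>n. norm (mscale (t ^ n / fact n) (mpoch M n)))"
  proof (rule summable_comparison_test')
    show "summable (\<lambda>n. K * (cmod t / r) ^ n)"
      using r \<open>0 < r\<close> by (intro summable_mult summable_geometric) simp
    fix n :: nat
    have "norm (mscale (t ^ n / fact n) (mpoch M n)) \<le> cmod t ^ n / fact n * (K * (1 / r) ^ n * fact n)"
      unfolding norm_mscale using K by (intro mult_mono) (simp_all add: norm_divide norm_power)
    then show "norm (norm (mscale (t ^ n / fact n) (mpoch M n))) \<le> K * (cmod t / r) ^ n"
      by (simp add: power_divide mult_ac)
  qed
  then show ?thesis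
    unfolding mbinom_def by (rule summable_sums[OF summable_norm_cancel])
qed

text \<open>Comparing coefficients, this is \<open>(M + 1)\<^sub>n - n (M + 1)\<^bsub>n -
  1\<^esub> = (M)\<^sub>n\<close>.\<close>
lemma mbinom_plus_1:
  fixes M :: "complex ^ 'd ^ 'd"
  assumes "cmod t < 1"
  shows "mscale (1 - t) (mbinom t (M + mat 1)) = mbinom t M"
proof -
  let ?S = "mbinom t (M + mat 1)"
  define f where "f = (\<lambda>n. mscale (t ^ n / fact n) (mpoch (M + mat 1) n))"
  \<comment> \<open>The terms of \<open>t\<close> times the series, moved to the power of \<open>t\<close> that they carry.\<close>
  define g where "g = (\<lambda>n. case n of 0 \<Rightarrow> 0 | Suc k \<Rightarrow> mscale t (f k))"
  have f: "f sums ?S" unfolding f_def by (rule mbinom_sums) fact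
  have "(\<lambda>n. g (Suc n)) sums mscale t ?S"
    using bounded_linear.sums[OF bounded_linear_mscale f] by (simp add: g_def)
  then have "g sums mscale t ?S"
    by (subst (asm) sums_Suc_iff) (simp add: g_def)
  then have "(\<lambda>n. f n - g n) sums (?S - mscale t ?S)"
    using f by (intro sums_diff)
  moreover have "f n - g n = mscale (t ^ n / fact n) (mpoch M n)" for n
  proof (cases n)
    case 0
    then show ?thesis by (simp add: f_def g_def)
  next
    case (Suc k)
    have "mpoch M n = M ** mpoch (M + mat 1) k"
      using mpoch_add[of M 1 k] by (simp add: Suc)
    also have "\<dots> = mpoch (M + mat 1) k ** M"
      by (rule mpoch_commute[symmetric]) (rule commute_add_mat, rule refl)
    finally have e: "mpoch (M + mat 1) n = mpoch M n + mscale (of_nat n) (mpoch (M + mat 1) k)"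
      by (simp add: Suc matrix_add_ldistrib mat_mult_right add.assoc mat_add)
    have "t ^ n / fact n * of_nat n = t * (t ^ k / fact k)"
      using of_nat_neq_0[of k, where 'a = complex] by (simp add: Suc divide_simps)
    then show ?thesis
      unfolding f_def g_def e by (simp add: Suc vec_eq_iff distrib_left flip: mult.assoc)
  qed
  ultimately have "mbinom t M = ?S - mscale t ?S"
    using mbinom_sums[OF assms, of M] sums_unique2 by simp
  then show ?thesis by (simp add: vec_eq_iff algebra_simps)
qed

lemma mbinom_plus_int:
  fixes M :: "complex ^ 'd ^ 'd"
  assumes "cmod t < 1"
  shows "mbinom t (M + mat (of_int p)) = mscale ((1 - t) powi (- p)) (mbinom t M)"
proof -
  have nz: "1 - t \<noteq> 0" using assms by auto
  have step: "mbinom t (M + mat (of_int (i + 1))) = mscale (1 / (1 - t)) (mbinom t (M + mat (of_int i)))" for i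
  proof -
    have "M + mat (of_int i) + mat 1 = M + mat (of_int (i + 1))"
      by (simp add: add.assoc mat_add)
    then have "mscale (1 - t) (mbinom t (M + mat (of_int (i + 1)))) = mbinom t (M + mat (of_int i))"
      using mbinom_plus_1[OF assms, of "M + mat (of_int i)"] by (simp only:)
    then have "mscale (1 / (1 - t)) (mscale (1 - t) (mbinom t (M + mat (of_int (i + 1))))) =
        mscale (1 / (1 - t)) (mbinom t (M + mat (of_int i)))"
      by simp
    then show ?thesis using nz by simp
  qed
  show ?thesis
  proof (induction p rule: int_induct[of _ 0])
    case base
    show ?case by simp
  next
    case (step1 i)
    have "(1 - t) powi (- (i + 1)) = 1 / (1 - t) * (1 - t) powi (- i)"
      using nz power_int_add[of "1 - t" "- i" "- 1"] by (simp add: power_int_minus field_simps)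
    then show ?case unfolding step step1 by simp
  next
    case (step2 i)
    have "mscale (1 - t) (mbinom t (M + mat (of_int i))) = mbinom t (M + mat (of_int (i - 1)))"
      using step[of "i - 1"] nz by simp
    moreover have "(1 - t) powi (- (i - 1)) = (1 - t) * (1 - t) powi (- i)"
      using nz power_int_add[of "1 - t" "- i" 1] by (simp add: field_simps)
    ultimately show ?case using step2 by (metis mscale_mscale)
  qed
qed

lemma holomorphic_mbinom: "(\<lambda>s. mbinom s M $ i $ j) holomorphic_on ball 0 1"
proof (rule higher_deriv_of_sums(1))
  fix s :: complex assume "cmod s < 1"
  from bounded_linear.sums[OF bounded_linear_entry mbinom_sums[OF this]]
  show "(\<lambda>n. mpoch M n $ i $ j / fact n * s ^ n) sums (mbinom s M $ i $ j)"
    by (simp add: mult_ac)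
qed simp

lemma mbinom_bounded_on_compact:
  fixes M :: "complex ^ 'd ^ 'd"
  assumes "compact K" "K \<subseteq> ball 0 1"
  obtains b where "\<And>s. s \<in> K \<Longrightarrow> norm (mbinom s M) \<le> b"
proof -
  have "continuous_on K (\<lambda>s. \<Sum>i\<in>UNIV. \<Sum>j\<in>UNIV. cmod (mbinom s M $ i $ j))"
    by (intro continuous_on_sum continuous_on_norm holomorphic_on_imp_continuous_on
        holomorphic_on_subset[OF holomorphic_mbinom] assms)
  then have "bounded ((\<lambda>s. \<Sum>i\<in>UNIV. \<Sum>j\<in>UNIV. cmod (mbinom s M $ i $ j)) ` K)"
    using assms(1) by (intro compact_imp_bounded compact_continuous_image)
  then obtain b where "\<And>s. s \<in> K \<Longrightarrow> norm (\<Sum>i\<in>UNIV. \<Sum>j\<in>UNIV. cmod (mbinom s M $ i $ j)) \<le> b"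
    by (auto simp: bounded_iff)
  then have "norm (mbinom s M) \<le> b" if "s \<in> K" for s
    using that norm_le_sum_entries[of "mbinom s M"] by fastforce
  then show thesis by (rule that)
qed

section \<open>Binomial generating series\<close>

text \<open>The common core of the three formulae. Each term \<open>(1 - s)\<^bsup>-M\<^esup> (1 -
  s)\<^bsup>-p\<^esup> E = (1 - s)\<^bsup>-(M + p)\<^esup> E\<close> of \<open>L s\<close> is
  holomorphic in the unit disc with Taylor coefficients \<open>(M + p)\<^sub>n E / n!\<close>.
  Differentiating the sum over \<open>q\<close> term by term at \<open>0\<close> therefore
  identifies \<open>c n / n!\<close> as the Taylor coefficients of \<open>L\<close>. The series
  converges in every disc about \<open>0\<close> inside \<open>U\<close>, and where it converges
  at a point of \<open>U\<close> on the boundary or beyond that disc, continuation and Abel's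
  theorem give its sum. The operation \<open>pr\<close> is the matrix product or the product with
  the factors exchanged.\<close>
lemma binomial_generating_series:
  fixes pr :: "complex ^ 'd ^ 'd \<Rightarrow> complex ^ 'd ^ 'd \<Rightarrow> complex ^ 'd ^ 'd"
    and M :: "complex ^ 'd ^ 'd" and E :: "'a \<Rightarrow> complex ^ 'd ^ 'd" and p :: "'a \<Rightarrow> int"
  assumes bil: "bounded_bilinear pr"
    and scale: "\<And>c a b. pr (mscale c a) b = mscale c (pr a b)" "\<And>c a b. pr a (mscale c b) = mscale c (pr a b)"
    and U: "open U" "0 \<in> U" "U \<subseteq> ball 0 1"
    and dom: "\<And>K. compact K \<Longrightarrow> K \<subseteq> U \<Longrightarrow>
      \<exists>b. b summable_on UNIV \<and> (\<forall>s\<in>K. \<forall>q. norm (mscale ((1 - s) powi (- p q)) (E q)) \<le> b q)"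
    and L: "\<And>s. s \<in> U \<Longrightarrow> L s = pr (mbinom s M) (\<Sum>\<^sub>\<infinity>q. mscale ((1 - s) powi (- p q)) (E q))"
    and c: "\<And>n. c n = (\<Sum>\<^sub>\<infinity>q. pr (mpoch (M + mat (of_int (p q))) n) (E q))"
  shows "ball 0 R \<subseteq> U \<Longrightarrow> cmod t < R \<Longrightarrow> summable (\<lambda>n. mscale (t ^ n / fact n) (c n))"
    and "t \<in> U \<Longrightarrow> connected (U \<inter> ball 0 (cmod t)) \<Longrightarrow> summable (\<lambda>n. mscale (t ^ n / fact n) (c n)) \<Longrightarrow>
      (\<lambda>n. mscale (t ^ n / fact n) (c n)) sums L t"
proof -
  define g where "g = (\<lambda>i j q s. pr (mbinom s M) (mscale ((1 - s) powi (- p q)) (E q)) $ i $ j)"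
  define f where "f = (\<lambda>i j s. \<Sum>\<^sub>\<infinity>q. g i j q s)"
  obtain k where k: "k > 0" "\<And>a b. norm (pr a b) \<le> norm a * norm b * k"
    using bounded_bilinear.pos_bounded[OF bil] by blast
  have taylor: "(\<lambda>n. pr (mpoch (M + mat (of_int (p q))) n) (E q) $ i $ j / fact n * s ^ n) sums g i j q s"
    if s: "cmod s < 1" for i j q s
  proof -
    have "(\<lambda>n. pr (mscale (s ^ n / fact n) (mpoch (M + mat (of_int (p q))) n)) (E q) $ i $ j) sums
        (pr (mbinom s (M + mat (of_int (p q)))) (E q) $ i $ j)"
      by (intro bounded_linear.sums[OF bounded_linear_entry]
          bounded_linear.sums[OF bounded_bilinear.bounded_linear_left[OF bil]] mbinom_sums s)
    then show ?thesis
      by (simp add: g_def mbinom_plus_int[OF s] scale mult_ac)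
  qed
  have ghol: "g i j q holomorphic_on U" for i j q
    using U(3) by (intro holomorphic_on_subset[OF higher_deriv_of_sums(1)[OF zero_less_one taylor]])
  have gder: "(deriv ^^ n) (g i j q) 0 = pr (mpoch (M + mat (of_int (p q))) n) (E q) $ i $ j" for i j q n
    by (subst higher_deriv_of_sums(2)[OF zero_less_one taylor]) simp_all
  have gdom: "\<exists>b. b summable_on UNIV \<and> (\<forall>s\<in>K. \<forall>q. norm (g i j q s) \<le> b q)"
    if K: "compact K" "K \<subseteq> U" for i j K
  proof -
    obtain b where b: "b summable_on UNIV" "\<And>s q. s \<in> K \<Longrightarrow> norm (mscale ((1 - s) powi (- p q)) (E q)) \<le> b q"
      using dom[OF K] by blast
    obtain B where B: "\<And>s. s \<in> K \<Longrightarrow> norm (mbinom s M) \<le> B"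
      using mbinom_bounded_on_compact[of K M] K U(3) by blast
    have "norm (g i j q s) \<le> B * b q * k" if s: "s \<in> K" for q s
    proof -
      have "norm (g i j q s) \<le> norm (mbinom s M) * norm (mscale ((1 - s) powi (- p q)) (E q)) * k"
        unfolding g_def by (rule order_trans[OF norm_entry_le k(2)])
      also have "\<dots> \<le> B * b q * k"
        using k(1) B[OF s] b(2)[OF s] order_trans[OF norm_ge_zero B[OF s]]
        by (intro mult_right_mono mult_mono) simp_all
      finally show ?thesis .
    qed
    moreover have "(\<lambda>q. B * b q * k) summable_on UNIV"
      by (intro summable_on_cmult_left summable_on_cmult_right b)
    ultimately show ?thesis by blast
  qed
  have fhol: "f i j holomorphic_on U" for i j
    unfolding f_def by (rule holomorphic_infsum(1)[OF U(1) ghol gdom])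
  have fder: "((\<lambda>q. pr (mpoch (M + mat (of_int (p q))) n) (E q) $ i $ j) has_sum (deriv ^^ n) (f i j) 0) UNIV" for i j n
    using holomorphic_infsum(2)[OF U(1) ghol gdom U(2), where n = n] by (simp add: gder f_def)
  have fL: "f i j s = L s $ i $ j" if "s \<in> U" for i j s
  proof -
    obtain b where b: "b summable_on UNIV" "\<And>q. norm (mscale ((1 - s) powi (- p q)) (E q)) \<le> b q"
      using dom[of "{s}"] \<open>s \<in> U\<close> by auto
    have "(\<lambda>q. mscale ((1 - s) powi (- p q)) (E q)) summable_on UNIV"
      by (rule abs_summable_summable, rule summable_on_comparison_test[OF b(1)]) (use b in auto)
    then have "((\<lambda>q. g i j q s) has_sum L s $ i $ j) UNIV"
      unfolding g_def L[OF that]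
      by (intro has_sum_bounded_linear[OF bounded_linear_entry]
          has_sum_bounded_linear[OF bounded_bilinear.bounded_linear_right[OF bil]] has_sum_infsum)
    then show ?thesis by (simp add: f_def infsumI)
  qed
  have c_entry: "c n $ i $ j = (deriv ^^ n) (f i j) 0" for n i j
  proof -
    have "((\<lambda>q. pr (mpoch (M + mat (of_int (p q))) n) (E q)) has_sum (\<chi> i j. (deriv ^^ n) (f i j) 0)) UNIV"
      by (rule has_sum_matrixI) (simp add: fder)
    then show ?thesis by (simp add: c infsumI)
  qed
  show "summable (\<lambda>n. mscale (t ^ n / fact n) (c n))" if R: "ball 0 R \<subseteq> U" "cmod t < R"
  proof (rule sums_summable, rule sums_matrixI)
    fix i j
    have "(\<lambda>n. (deriv ^^ n) (f i j) 0 / fact n * (t - 0) ^ n) sums f i j t"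
      using R by (intro holomorphic_power_series holomorphic_on_subset[OF fhol]) auto
    then show "(\<lambda>n. mscale (t ^ n / fact n) (c n) $ i $ j) sums ((\<chi> i j. f i j t) $ i $ j)"
      by (simp add: c_entry mult_ac)
  qed
  show "(\<lambda>n. mscale (t ^ n / fact n) (c n)) sums L t"
    if t: "t \<in> U" "connected (U \<inter> ball 0 (cmod t))" and summ: "summable (\<lambda>n. mscale (t ^ n / fact n) (c n))"
  proof (rule sums_matrixI)
    fix i j
    have "summable (\<lambda>n. mscale (t ^ n / fact n) (c n) $ i $ j)"
      using summ by (intro summable_vec_nth)
    then have "(\<lambda>n. (deriv ^^ n) (f i j) 0 / fact n * t ^ n) sums f i j t"
      by (intro Taylor_sums_at_boundary[OF U(1,2) t fhol]) (simp add: c_entry mult_ac)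
    then show "(\<lambda>n. mscale (t ^ n / fact n) (c n) $ i $ j) sums (L t $ i $ j)"
      by (simp add: c_entry fL t mult_ac)
  qed
qed

section \<open>The Horn function and its parameter shifts\<close>

lemma horn_H11_eq:
  "horn_H11 A B C C' x y = (\<Sum>\<^sub>\<infinity>q. mscale (x ^ fst q * y ^ snd q) (H11_coeff A B C C' q))"
  unfolding horn_H11_def H11_coeff_def by (rule infsum_cong) (simp add: case_prod_beta)

text \<open>A Weierstrass majorant for the Horn series at arguments that vary continuously over a
  compact set: \<open>\<bar>u\<bar>\<close> and \<open>\<bar>v\<bar>\<close> attain their maxima
  on \<open>K\<close>, and the maximum of \<open>\<bar>v\<bar>\<close> is still below
  \<open>1\<close>.\<close>
lemma H11_dominated:
  fixes A B C C' :: "complex ^ 'd ^ 'd" and u v :: "'a :: topological_space \<Rightarrow> complex"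
  assumes C': "\<And>k::nat. invertible (C' + mat (of_nat k))"
    and A: "\<And>k::nat. k \<ge> 1 \<Longrightarrow> invertible (A - mat (of_nat k))"
    and K: "compact K" and u: "continuous_on K u" and v: "continuous_on K v"
    and v1: "\<And>s. s \<in> K \<Longrightarrow> cmod (v s) < 1"
  shows "\<exists>b. b summable_on UNIV \<and>
    (\<forall>s\<in>K. \<forall>q. norm (mscale (u s ^ fst q * v s ^ snd q) (H11_coeff A B C C' q)) \<le> b q)"
proof (cases "K = {}")
  case True
  then show ?thesis by (intro exI[of _ "\<lambda>_. 0"]) simp
next
  case False
  obtain X where X: "\<And>s. s \<in> K \<Longrightarrow> cmod (u s) \<le> X"
    using continuous_attains_sup[OF K False, of "\<lambda>s. cmod (u s)"] u continuous_on_norm by blast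
  obtain s0 where s0: "s0 \<in> K" "\<And>s. s \<in> K \<Longrightarrow> cmod (v s) \<le> cmod (v s0)"
    using continuous_attains_sup[OF K False, of "\<lambda>s. cmod (v s)"] v continuous_on_norm by blast
  define Y where "Y = cmod (v s0)"
  have "0 \<le> X" using X[OF s0(1)] norm_ge_zero order_trans by blast
  have "(\<lambda>(m, k). X ^ m * Y ^ k * norm (H11_coeff A B C C' (m, k))) summable_on UNIV"
    by (rule H11_majorant_summable[OF C' A \<open>0 \<le> X\<close>]) (use v1[OF s0(1)] in \<open>simp_all add: Y_def\<close>)
  moreover have "norm (mscale (u s ^ fst q * v s ^ snd q) (H11_coeff A B C C' q))
      \<le> (case q of (m, k) \<Rightarrow> X ^ m * Y ^ k * norm (H11_coeff A B C C' (m, k)))" if "s \<in> K" for s q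
    unfolding norm_mscale norm_mult norm_power case_prod_beta prod.collapse
    using X[OF that] s0(2)[OF that] \<open>0 \<le> X\<close>
    by (intro mult_right_mono mult_mono power_mono) (simp_all add: Y_def)
  ultimately show ?thesis by blast
qed

lemma horn_H11_has_sum:
  fixes A B C C' :: "complex ^ 'd ^ 'd"
  assumes C': "\<And>k::nat. invertible (C' + mat (of_nat k))"
    and A: "\<And>k::nat. k \<ge> 1 \<Longrightarrow> invertible (A - mat (of_nat k))"
    and y: "cmod y < 1"
  shows "((\<lambda>q. mscale (x ^ fst q * y ^ snd q) (H11_coeff A B C C' q)) has_sum horn_H11 A B C C' x y) UNIV"
proof -
  obtain b where b: "b summable_on UNIV"
      "\<And>q. norm (mscale (x ^ fst q * y ^ snd q) (H11_coeff A B C C' q)) \<le> b q"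
    using H11_dominated[OF C' A, of "{0::real}" "\<lambda>_. x" "\<lambda>_. y" B C] y by auto
  have "(\<lambda>q. mscale (x ^ fst q * y ^ snd q) (H11_coeff A B C C' q)) summable_on UNIV"
    by (rule abs_summable_summable, rule summable_on_comparison_test[OF b(1)]) (use b in auto)
  then show ?thesis unfolding horn_H11_eq by (rule has_sum_infsum)
qed

lemma horn_H11_matrix_mult:
  fixes A B C C' P :: "complex ^ 'd ^ 'd"
  assumes "\<And>k::nat. invertible (C' + mat (of_nat k))"
    and "\<And>k::nat. k \<ge> 1 \<Longrightarrow> invertible (A - mat (of_nat k))"
    and "cmod y < 1"
  shows "P ** horn_H11 A B C C' x y = (\<Sum>\<^sub>\<infinity>q. mscale (x ^ fst q * y ^ snd q) (P ** H11_coeff A B C C' q))"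
    and "horn_H11 A B C C' x y ** P = (\<Sum>\<^sub>\<infinity>q. mscale (x ^ fst q * y ^ snd q) (H11_coeff A B C C' q ** P))"
  using has_sum_bounded_linear[OF bounded_bilinear.bounded_linear_right[OF bounded_bilinear_matrix_mult, of P]
      horn_H11_has_sum[OF assms, of x B C]]
    has_sum_bounded_linear[OF bounded_bilinear.bounded_linear_left[OF bounded_bilinear_matrix_mult, of P]
      horn_H11_has_sum[OF assms, of x B C]]
  by (simp_all add: infsumI mscale_mult_left mscale_mult_right)

lemma H11_coeff_shift_A:
  fixes A B C C' :: "complex ^ 'd ^ 'd"
  assumes "\<And>k. k \<ge> 1 \<Longrightarrow> invertible (A - mat (of_nat k))" "\<And>k. invertible (A + mat (of_nat k))"
  shows "mpoch A n ** H11_coeff (A + mat (of_nat n)) B C C' q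
    = mpoch (A + mat (of_int (int (fst q) - int (snd q)))) n ** H11_coeff A B C C' q"
  by (simp only: H11_coeff_def case_prod_beta mscale_mult_right matrix_mul_assoc mpoch_int_shift[OF assms])

text \<open>The factor \<open>(B)\<^sub>n\<close> has to pass the symbol of \<open>A\<close>
  before it meets the symbol of \<open>B + nI\<close>; this is where \<open>AB = BA\<close>
  enters.\<close>
lemma H11_coeff_shift_B:
  fixes A B C C' :: "complex ^ 'd ^ 'd"
  assumes A: "\<And>k. k \<ge> 1 \<Longrightarrow> invertible (A - mat (of_nat k))" and AB: "A ** B = B ** A"
  shows "mpoch B n ** H11_coeff A (B + mat (of_nat n)) C C' q
    = mpoch (B + mat (of_nat (snd q))) n ** H11_coeff A B C C' q"
proof -
  define P where "P = mpoch_int A (int (fst q) - int (snd q))"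
  have BP: "B ** P = P ** B"
    unfolding P_def by (rule sym, rule mpoch_int_commute[OF A AB])
  have "mpoch B n ** (P ** mpoch (B + mat (of_nat n)) (snd q))
      = P ** (mpoch B n ** mpoch (B + mat (of_nat n)) (snd q))"
    by (simp only: matrix_mul_assoc mpoch_commute[OF BP])
  also have "\<dots> = P ** (mpoch (B + mat (of_nat (snd q))) n ** mpoch B (snd q))"
    by (simp only: mpoch_shift)
  also have "\<dots> = mpoch (B + mat (of_nat (snd q))) n ** (P ** mpoch B (snd q))"
    by (simp only: matrix_mul_assoc mpoch_commute[OF commute_add_mat[OF BP]])
  finally show ?thesis
    by (simp add: H11_coeff_def case_prod_beta mscale_mult_right matrix_mul_assoc flip: P_def)
qed

text \<open>Here \<open>(C)\<^sub>n\<close> comes from the right and has to pass the inverse of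
  \<open>(C')\<^sub>m\<close>.\<close>
lemma H11_coeff_shift_C:
  fixes A B C C' :: "complex ^ 'd ^ 'd"
  assumes C': "\<And>k. invertible (C' + mat (of_nat k))" and CC': "C ** C' = C' ** C"
  shows "H11_coeff A B (C + mat (of_nat n)) C' q ** mpoch C n
    = H11_coeff A B C C' q ** mpoch (C + mat (of_nat (snd q))) n"
proof -
  define P where "P = matrix_inv (mpoch C' (fst q))"
  have CP: "C ** P = P ** C"
    unfolding P_def by (intro sym[OF matrix_inv_commute] invertible_mpoch C' mpoch_commute sym[OF CC'])
  have "mpoch (C + mat (of_nat n)) (snd q) ** P ** mpoch C n
      = mpoch (C + mat (of_nat n)) (snd q) ** mpoch C n ** P"
    by (simp only: matrix_mul_assoc[symmetric] mpoch_commute[OF CP])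
  also have "mpoch (C + mat (of_nat n)) (snd q) ** mpoch C n = mpoch C n ** mpoch (C + mat (of_nat n)) (snd q)"
    by (intro mpoch_commute_mpoch commute_add_mat refl)
  also have "\<dots> = mpoch (C + mat (of_nat (snd q))) n ** mpoch C (snd q)"
    by (rule mpoch_shift)
  also have "\<dots> = mpoch C (snd q) ** mpoch (C + mat (of_nat (snd q))) n"
    by (intro mpoch_commute_mpoch commute_add_mat refl)
  also have "\<dots> ** P = mpoch C (snd q) ** P ** mpoch (C + mat (of_nat (snd q))) n"
    by (simp only: matrix_mul_assoc[symmetric] mpoch_commute[OF commute_add_mat[OF CP]])
  finally show ?thesis
    by (simp add: H11_coeff_def case_prod_beta mscale_mult_left flip: P_def matrix_mul_assoc)
qed

theorem theorem5p23:
  fixes A B C C' :: "complex ^ 'd ^ 'd" and x y t :: complex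
  assumes C: "\<And>k::nat. invertible (C + mat (of_nat k))"
    and C': "\<And>k::nat. invertible (C' + mat (of_nat k))"
    and A: "\<And>k::nat. k \<ge> 1 \<Longrightarrow> invertible (A - mat (of_nat k))"
    and xy: "(x, y) \<in> horn_H11_region"
    and t: "cmod t < 1"
  shows
    "((\<forall>k::nat. invertible (A + mat (of_nat k))) \<longrightarrow>
      (x / (1 - t), y * (1 - t)) \<in> horn_H11_region \<longrightarrow>
      (cmod y * (1 + cmod t) < 1 \<longrightarrow>
        summable (\<lambda>n. mscale (t ^ n / fact n)
          (mpoch A n ** horn_H11 (A + mat (of_nat n)) B C C' x y))) \<and>
      (summable (\<lambda>n. mscale (t ^ n / fact n)
          (mpoch A n ** horn_H11 (A + mat (of_nat n)) B C C' x y)) \<longrightarrow>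
        mbinom t A ** horn_H11 A B C C' (x / (1 - t)) (y * (1 - t)) =
        (\<Sum>n. mscale (t ^ n / fact n)
          (mpoch A n ** horn_H11 (A + mat (of_nat n)) B C C' x y)))) \<and>
     (A ** B = B ** A \<longrightarrow>
      (x, y / (1 - t)) \<in> horn_H11_region \<longrightarrow>
      (cmod y + cmod t < 1 \<longrightarrow>
        summable (\<lambda>n. mscale (t ^ n / fact n)
          (mpoch B n ** horn_H11 A (B + mat (of_nat n)) C C' x y))) \<and>
      (summable (\<lambda>n. mscale (t ^ n / fact n)
          (mpoch B n ** horn_H11 A (B + mat (of_nat n)) C C' x y)) \<longrightarrow>
        mbinom t B ** horn_H11 A B C C' x (y / (1 - t)) =
        (\<Sum>n. mscale (t ^ n / fact n)
          (mpoch B n ** horn_H11 A (B + mat (of_nat n)) C C' x y)))) \<and>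
     (C ** C' = C' ** C \<longrightarrow>
      (x, y / (1 - t)) \<in> horn_H11_region \<longrightarrow>
      (cmod y + cmod t < 1 \<longrightarrow>
        summable (\<lambda>n. mscale (t ^ n / fact n)
          (horn_H11 A B (C + mat (of_nat n)) C' x y ** mpoch C n))) \<and>
      (summable (\<lambda>n. mscale (t ^ n / fact n)
          (horn_H11 A B (C + mat (of_nat n)) C' x y ** mpoch C n)) \<longrightarrow>
        horn_H11 A B C C' x (y / (1 - t)) ** mbinom t C =
        (\<Sum>n. mscale (t ^ n / fact n)
          (horn_H11 A B (C + mat (of_nat n)) C' x y ** mpoch C n))))"
proof -
  note mult_bilinear = bounded_bilinear_matrix_mult[where 'd = 'd]
  have flip_bilinear: "bounded_bilinear (\<lambda>(P :: complex ^ 'd ^ 'd) (Q :: complex ^ 'd ^ 'd). Q ** P)"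
    by (rule bounded_bilinear.flip[OF mult_bilinear])
  have y: "cmod y < 1" using xy by (simp add: horn_H11_region_def)
  have nz: "1 - s \<noteq> 0" if "cmod s < 1" for s :: complex using that by auto
  define E where "E = (\<lambda>q. mscale (x ^ fst q * y ^ snd q) (H11_coeff A B C C' q))"

  \<comment> \<open>The values of \<open>t\<close> for which the left-hand sides make sense: \<open>U\<close> for the first formula, \<open>V\<close> for the other two.\<close>
  define U where "U = ball 0 1 \<inter> {s. cmod (y * (1 - s)) < 1}"
  define V where "V = ball 0 1 \<inter> {s. cmod y < cmod (1 - s)}"
  have Uopen: "open U" and Vopen: "open V"
    unfolding U_def V_def by (intro open_Int open_ball open_Collect_less continuous_intros)+
  have U0: "0 \<in> U" "U \<subseteq> ball 0 1" and V0: "0 \<in> V" "V \<subseteq> ball 0 1"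
    using y by (auto simp: U_def V_def)
  have Uconn: "connected (U \<inter> ball 0 r)" for r
  proof (rule convex_connected)
    have "convex {s. cmod (y * (1 - s)) < 1}"
    proof (cases "y = 0")
      case False
      then have "{s. cmod (y * (1 - s)) < 1} = ball 1 (1 / cmod y)"
        by (auto simp: norm_mult dist_norm pos_less_divide_eq mult.commute)
      then show ?thesis by simp
    qed simp
    then show "convex (U \<inter> ball 0 r)"
      unfolding U_def by (intro convex_Int convex_ball)
  qed
  have Vconn: "connected (V \<inter> ball 0 r)" for r
  proof -
    have "V \<inter> ball 0 r = {s. cmod s < min 1 r \<and> cmod y < cmod (1 - s)}"
      by (auto simp: V_def)
    then show ?thesis using connected_ball_minus_cball[of "cmod y" "min 1 r"] y by simp
  qed
  \<comment> \<open>The case \<open>y = 0\<close> is separate because \<open>1 / 0 = 0\<close> would make the radius negative.\<close>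
  have Uball: "ball 0 (if y = 0 then 1 else min 1 (1 / cmod y - 1)) \<subseteq> U"
  proof
    fix s :: complex assume s: "s \<in> ball 0 (if y = 0 then 1 else min 1 (1 / cmod y - 1))"
    show "s \<in> U"
    proof (cases "y = 0")
      case False
      have "cmod (y * (1 - s)) \<le> cmod y * (1 + cmod s)"
        unfolding norm_mult by (intro mult_left_mono order_trans[OF norm_triangle_ineq4]) auto
      also have "\<dots> < 1" using s False by (simp add: field_simps)
      finally show ?thesis using s False by (simp add: U_def)
    qed (use s in \<open>simp add: U_def\<close>)
  qed
  have Vball: "ball 0 (1 - cmod y) \<subseteq> V"
  proof
    fix s :: complex assume "s \<in> ball 0 (1 - cmod y)"
    then have "cmod s < 1 - cmod y" by simp
    moreover have "1 - cmod s \<le> cmod (1 - s)" using norm_triangle_ineq2[of 1 s] by simp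
    ultimately have "cmod y < cmod (1 - s)" "cmod s < 1" using norm_ge_zero[of y] by linarith+
    then show "s \<in> V" by (simp add: V_def)
  qed

  have EU: "mscale ((1 - s) powi (- (int (fst q) - int (snd q)))) (E q)
      = mscale ((x / (1 - s)) ^ fst q * (y * (1 - s)) ^ snd q) (H11_coeff A B C C' q)"
    if "cmod s < 1" for s q
  proof -
    have "(1 - s) powi (- (int (fst q) - int (snd q))) = (1 - s) ^ snd q / (1 - s) ^ fst q"
      using nz[OF that] by (simp add: power_int_diff)
    then show ?thesis by (simp add: E_def power_mult_distrib power_divide mult_ac)
  qed
  have EV: "mscale ((1 - s) powi (- int (snd q))) (E q)
      = mscale (x ^ fst q * (y / (1 - s)) ^ snd q) (H11_coeff A B C C' q)" for s q
    by (simp add: E_def power_divide power_int_minus field_simps)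
  have Udom: "\<exists>b. b summable_on UNIV \<and>
      (\<forall>s\<in>K. \<forall>q. norm (mscale ((1 - s) powi (- (int (fst q) - int (snd q)))) (E q)) \<le> b q)"
    if K: "compact K" "K \<subseteq> U" for K
  proof -
    have K1: "cmod s < 1" "cmod (y * (1 - s)) < 1" if "s \<in> K" for s
      using that K(2) by (auto simp: U_def)
    have "\<exists>b. b summable_on UNIV \<and>
      (\<forall>s\<in>K. \<forall>q. norm (mscale ((x / (1 - s)) ^ fst q * (y * (1 - s)) ^ snd q) (H11_coeff A B C C' q)) \<le> b q)"
      by (rule H11_dominated[OF C' A K(1)]) (use K1 nz in \<open>auto intro!: continuous_intros\<close>)
    then show ?thesis using EU K1(1) by simp
  qed
  have Vdom: "\<exists>b. b summable_on UNIV \<and>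
      (\<forall>s\<in>K. \<forall>q. norm (mscale ((1 - s) powi (- int (snd q))) (E q)) \<le> b q)"
    if K: "compact K" "K \<subseteq> V" for K
  proof -
    have K1: "1 - s \<noteq> 0" "cmod (y / (1 - s)) < 1" if "s \<in> K" for s
    proof -
      have "cmod s < 1" "cmod y < cmod (1 - s)" using that K(2) by (auto simp: V_def)
      then show "1 - s \<noteq> 0" "cmod (y / (1 - s)) < 1" using nz[of s] by (simp_all add: norm_divide)
    qed
    show ?thesis unfolding EV
      by (rule H11_dominated[OF C' A K(1)]) (use K1 in \<open>auto intro!: continuous_intros\<close>)
  qed
  have HU: "horn_H11 A B C C' (x / (1 - s)) (y * (1 - s))
      = (\<Sum>\<^sub>\<infinity>q. mscale ((1 - s) powi (- (int (fst q) - int (snd q)))) (E q))" if "s \<in> U" for s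
    unfolding horn_H11_eq by (rule infsum_cong) (use EU U0 that in auto)
  have HV: "horn_H11 A B C C' x (y / (1 - s)) = (\<Sum>\<^sub>\<infinity>q. mscale ((1 - s) powi (- int (snd q))) (E q))" for s
    unfolding horn_H11_eq EV ..

  have part1: "(cmod y * (1 + cmod t) < 1 \<longrightarrow> summable (\<lambda>n. mscale (t ^ n / fact n)
          (mpoch A n ** horn_H11 (A + mat (of_nat n)) B C C' x y))) \<and>
      (summable (\<lambda>n. mscale (t ^ n / fact n)
          (mpoch A n ** horn_H11 (A + mat (of_nat n)) B C C' x y)) \<longrightarrow>
        mbinom t A ** horn_H11 A B C C' (x / (1 - t)) (y * (1 - t)) =
        (\<Sum>n. mscale (t ^ n / fact n) (mpoch A n ** horn_H11 (A + mat (of_nat n)) B C C' x y)))"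
    if nonneg: "\<forall>k::nat. invertible (A + mat (of_nat k))" and reg: "(x / (1 - t), y * (1 - t)) \<in> horn_H11_region"
  proof (intro conjI impI)
    have c: "mpoch A n ** horn_H11 (A + mat (of_nat n)) B C C' x y
        = (\<Sum>\<^sub>\<infinity>q. mpoch (A + mat (of_int (int (fst q) - int (snd q)))) n ** E q)" for n
    proof -
      have "mpoch A n ** horn_H11 (A + mat (of_nat n)) B C C' x y = (\<Sum>\<^sub>\<infinity>q. mscale (x ^ fst q * y ^ snd q)
          (mpoch A n ** H11_coeff (A + mat (of_nat n)) B C C' q))"
        by (rule horn_H11_matrix_mult(1)[OF C' _ y], rule invertible_add_sub_mat) (use A nonneg in auto)
      also have "\<dots> = (\<Sum>\<^sub>\<infinity>q. mpoch (A + mat (of_int (int (fst q) - int (snd q)))) n ** E q)"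
        by (subst H11_coeff_shift_A) (use A nonneg in \<open>auto simp: E_def mscale_mult_right\<close>)
      finally show ?thesis .
    qed
    note series = binomial_generating_series[OF mult_bilinear mscale_mult_left mscale_mult_right Uopen U0
        Udom arg_cong[where f = "(**) (mbinom _ A)", OF HU] c]
    show "summable (\<lambda>n. mscale (t ^ n / fact n) (mpoch A n ** horn_H11 (A + mat (of_nat n)) B C C' x y))"
      if "cmod y * (1 + cmod t) < 1"
      by (rule series(1)[OF _ _ _ Uball]) (use that t in \<open>auto simp: field_simps\<close>)
    assume "summable (\<lambda>n. mscale (t ^ n / fact n) (mpoch A n ** horn_H11 (A + mat (of_nat n)) B C C' x y))"
    then show "mbinom t A ** horn_H11 A B C C' (x / (1 - t)) (y * (1 - t)) =
        (\<Sum>n. mscale (t ^ n / fact n) (mpoch A n ** horn_H11 (A + mat (of_nat n)) B C C' x y))"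
      using reg t by (intro sums_unique series(2) Uconn) (simp_all add: U_def horn_H11_region_def)
  qed

  have tV: "t \<in> V" if "(x, y / (1 - t)) \<in> horn_H11_region"
    using that t nz[OF t] by (simp add: V_def horn_H11_region_def norm_divide)

  have part2: "(cmod y + cmod t < 1 \<longrightarrow> summable (\<lambda>n. mscale (t ^ n / fact n)
          (mpoch B n ** horn_H11 A (B + mat (of_nat n)) C C' x y))) \<and>
      (summable (\<lambda>n. mscale (t ^ n / fact n)
          (mpoch B n ** horn_H11 A (B + mat (of_nat n)) C C' x y)) \<longrightarrow>
        mbinom t B ** horn_H11 A B C C' x (y / (1 - t)) =
        (\<Sum>n. mscale (t ^ n / fact n) (mpoch B n ** horn_H11 A (B + mat (of_nat n)) C C' x y)))"
    if AB: "A ** B = B ** A" and reg: "(x, y / (1 - t)) \<in> horn_H11_region"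
  proof (intro conjI impI)
    have c: "mpoch B n ** horn_H11 A (B + mat (of_nat n)) C C' x y
        = (\<Sum>\<^sub>\<infinity>q. mpoch (B + mat (of_int (int (snd q)))) n ** E q)" for n
      by (simp add: horn_H11_matrix_mult(1)[OF C' A y] H11_coeff_shift_B[OF A AB] E_def mscale_mult_right)
    note series = binomial_generating_series[OF mult_bilinear mscale_mult_left mscale_mult_right Vopen V0
        Vdom arg_cong[where f = "(**) (mbinom _ B)", OF HV] c]
    show "summable (\<lambda>n. mscale (t ^ n / fact n) (mpoch B n ** horn_H11 A (B + mat (of_nat n)) C C' x y))"
      if "cmod y + cmod t < 1"
      by (rule series(1)[OF _ _ Vball]) (use that in auto)
    assume "summable (\<lambda>n. mscale (t ^ n / fact n) (mpoch B n ** horn_H11 A (B + mat (of_nat n)) C C' x y))"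
    then show "mbinom t B ** horn_H11 A B C C' x (y / (1 - t)) =
        (\<Sum>n. mscale (t ^ n / fact n) (mpoch B n ** horn_H11 A (B + mat (of_nat n)) C C' x y))"
      by (intro sums_unique series(2) Vconn tV[OF reg])
  qed

  have part3: "(cmod y + cmod t < 1 \<longrightarrow> summable (\<lambda>n. mscale (t ^ n / fact n)
          (horn_H11 A B (C + mat (of_nat n)) C' x y ** mpoch C n))) \<and>
      (summable (\<lambda>n. mscale (t ^ n / fact n)
          (horn_H11 A B (C + mat (of_nat n)) C' x y ** mpoch C n)) \<longrightarrow>
        horn_H11 A B C C' x (y / (1 - t)) ** mbinom t C =
        (\<Sum>n. mscale (t ^ n / fact n) (horn_H11 A B (C + mat (of_nat n)) C' x y ** mpoch C n)))"
    if CC': "C ** C' = C' ** C" and reg: "(x, y / (1 - t)) \<in> horn_H11_region"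
  proof (intro conjI impI)
    have c: "horn_H11 A B (C + mat (of_nat n)) C' x y ** mpoch C n
        = (\<Sum>\<^sub>\<infinity>q. E q ** mpoch (C + mat (of_int (int (snd q)))) n)" for n
      by (simp add: horn_H11_matrix_mult(2)[OF C' A y] H11_coeff_shift_C[OF C' CC'] E_def mscale_mult_left)
    note series = binomial_generating_series[OF flip_bilinear mscale_mult_right mscale_mult_left Vopen V0
        Vdom arg_cong[where f = "\<lambda>P. P ** mbinom _ C", OF HV] c]
    show "summable (\<lambda>n. mscale (t ^ n / fact n) (horn_H11 A B (C + mat (of_nat n)) C' x y ** mpoch C n))"
      if "cmod y + cmod t < 1"
      by (rule series(1)[OF _ _ Vball]) (use that in auto)
    assume "summable (\<lambda>n. mscale (t ^ n / fact n) (horn_H11 A B (C + mat (of_nat n)) C' x y ** mpoch C n))"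
    then show "horn_H11 A B C C' x (y / (1 - t)) ** mbinom t C =
        (\<Sum>n. mscale (t ^ n / fact n) (horn_H11 A B (C + mat (of_nat n)) C' x y ** mpoch C n))"
      by (intro sums_unique series(2) Vconn tV[OF reg])
  qed

  show ?thesis using part1 part2 part3 by blast
qed

end
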